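(* Assume the model is symmetric, i.e. $\lambda_i=\lambda$ and $|V_i|=V$ for all $i=1,\dots,K$. If $\lambda<e^{-1}/V$, then the fluid model is stable: there exists a deterministic time $t_0<\infty$ such that, almost surely, every fluid limit $z$ satisfies $z(t)=0$ for all $t\ge t_0$.
   Context: Model. $\mathcal G=(\mathcal V,\mathcal E)$ is a connected undirected graph with finite vertex set $\mathcal V=\{1,\dots,K\}$. For $i\in\mathcal V$, $V_i=\{i\}\cup\{j\in\mathcal V:(i,j)\in\mathcal E\}$ is the closed neighbourhood of $i$, and $|V_i|$ is its cardinality. Time is slotted, $n=0,1,2,\dots$. The arrival vectors $A(n)=(A_1(n),\dots,A_K(n))\in\mathbb N^K$ (with $\mathbb N=\{0,1,2,\dots\}$) form an i.i.d. sequence in $n$ (coordinates may be dependent), with $\mathbf E A_i(n)=\lambda_i\in(0,\infty)$. $W_i(n)$ is the number of users at vertex $i$ at time $n$. Given $W(n)$, the numbers $N_i(n)$ of users attempting transmission are independent over $i$, $N_i(n)$ being binomial with parameters $\bigl(W_i(n),1/\sum_{j\in V_i}W_j(n)\bigr)$ (and $N_i(n)=0$ if $W_i(n)=0$), and $$W_i(n)=W_i(n-1)+A_i(n)-\mathbf 1\{N_i(n-1)=1\}\prod_{j\in V_i\setminus\{i\}}\mathbf 1\{N_j(n-1)=0\}.$$ $W^x$ denotes this Markov chain on $\mathbb N^K$ with $W(0)=x$; the chains $W^x$, $x\in\mathbb N^K$, are defined on a common probability space and driven by the same arrivals. Fluid limits. $|x|=\sum_{k=1}^K|x_k|$ for $x\in\mathbb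 R^K$. For a sequence $x^n\in\mathbb N^K$ with $|x^n|\to\infty$ put $X^n(t)=W^{x^n}(\lceil|x^n|t\rceil)/|x^n|$, $t\ge0$. A fluid limit is any accumulation point $z$, in the Skorokhod topology on $\mathbb R^K$-valued c\`adl\`ag functions on $[0,\infty)$, of such a sequence $(X^n)$ (almost surely $(X^n)$ has compact closure). Fluid limits are a.s. Lipschitz continuous, satisfy $|z(0)|=1$ and $z_i(t)\ge0$, and may be random. The collection of all fluid limits is the fluid model. *)

theory Defs
  imports "HOL-Probability.Probability"
begin

section \<open>The random access model\<close>

definition closed_nbhd :: "('v \<times> 'v) set \<Rightarrow> 'v \<Rightarrow> 'v set" where
  "closed_nbhd E i = insert i {j. (i, j) \<in> E}"

text \<open>
  Joint law of the numbers of attempts, given the queue vector w. At a vertex with no users,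
  \<^term>\<open>binomial_pmf 0 p\<close> is the point mass at 0, whatever the value of p; at a vertex with
  at least one user the denominator is at least 1, so the attempt probability lies in (0,1].
\<close>
definition attempts_pmf :: "('v::finite \<times> 'v) set \<Rightarrow> ('v \<Rightarrow> nat) \<Rightarrow> ('v \<Rightarrow> nat) pmf" where
  "attempts_pmf E w =
     Pi_pmf UNIV 0 (\<lambda>i. binomial_pmf (w i) (1 / real (\<Sum>j\<in>closed_nbhd E i. w j)))"

definition past ::
    "(nat \<Rightarrow> 'w \<Rightarrow> 'v \<Rightarrow> nat) \<Rightarrow> (('v \<Rightarrow> nat) \<Rightarrow> nat \<Rightarrow> 'w \<Rightarrow> 'v \<Rightarrow> nat) \<Rightarrow>
     ('v \<Rightarrow> nat) \<Rightarrow> nat \<Rightarrow> 'w \<Rightarrow> ('v \<Rightarrow> nat) list \<times> ('v \<Rightarrow> nat) list" where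
  "past A N x n \<omega> = (map (\<lambda>k. A k \<omega>) [1..<Suc n], map (\<lambda>k. N x k \<omega>) [0..<n])"

text \<open>
  The vertex set is the finite type \<^typ>\<open>'v\<close>. \<open>A n \<omega> i\<close> is the number of arrivals at vertex i
  at time n; \<open>N x n \<omega> i\<close> and \<open>W x n \<omega> i\<close> are the number of attempts and of users at vertex i
  at time n in the chain started from x. The arrivals do not depend on x, and nothing is assumed
  about the joint law of the attempts of chains with different initial states.

  All random vectors take values in the countable type \<open>'v \<Rightarrow> nat\<close>, with its discrete
  sigma-algebra. The dynamics is specified with respect to \<open>past A N x n\<close>, the arrivals at times
  1, ..., n and the attempts at times 0, ..., n - 1, which determines the queue vector at time n:
  given the past, the attempts at time n have the law prescribed by the queue vector at time n, and
  the arrivals at time n + 1 are independent of the past and the attempts at time n. The recursion is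
  stated over the integers to avoid truncated subtraction.
\<close>
locale random_access_model = prob_space M
  for M :: "'w measure" +
  fixes E :: "('v::finite \<times> 'v) set"
    and arr_rate :: "'v \<Rightarrow> real"
    and A :: "nat \<Rightarrow> 'w \<Rightarrow> 'v \<Rightarrow> nat"
    and N :: "('v \<Rightarrow> nat) \<Rightarrow> nat \<Rightarrow> 'w \<Rightarrow> 'v \<Rightarrow> nat"
    and W :: "('v \<Rightarrow> nat) \<Rightarrow> nat \<Rightarrow> 'w \<Rightarrow> 'v \<Rightarrow> nat"
  assumes undirected: "sym E"
    and connected: "\<And>i j. (i, j) \<in> E\<^sup>*"
    and A_indep: "indep_vars (\<lambda>_. count_space UNIV) A UNIV"
    and A_ident: "\<And>n. distr M (count_space UNIV) (A n) = distr M (count_space UNIV) (A 0)"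
    and A_integrable: "\<And>n i. integrable M (\<lambda>\<omega>. real (A n \<omega> i))"
    and A_mean: "\<And>n i. expectation (\<lambda>\<omega>. real (A n \<omega> i)) = arr_rate i"
    and rate_pos: "\<And>i. arr_rate i > 0"
    and N_measurable: "\<And>x n. random_variable (count_space UNIV) (N x n)"
    and W_0: "\<And>x \<omega>. \<omega> \<in> space M \<Longrightarrow> W x 0 \<omega> = x"
    and W_Suc: "\<And>x n \<omega> i. \<omega> \<in> space M \<Longrightarrow>
          int (W x (Suc n) \<omega> i) = int (W x n \<omega> i) + int (A (Suc n) \<omega> i)
            - of_bool (N x n \<omega> i = 1) * (\<Prod>j\<in>closed_nbhd E i - {i}. of_bool (N x n \<omega> j = 0))"
    and N_law: "\<And>x n \<omega> y. \<omega> \<in> space M \<Longrightarrow> \<P>(\<eta> in M. past A N x n \<eta> = past A N x n \<omega>) > 0 \<Longrightarrow>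
            \<P>(\<eta> in M. N x n \<eta> = y \<bar> past A N x n \<eta> = past A N x n \<omega>) =
            pmf (attempts_pmf E (W x n \<omega>)) y"
    and A_indep_past: "\<And>x n. indep_set {A (Suc n) -` B \<inter> space M | B. True}
            {(\<lambda>\<omega>. (past A N x n \<omega>, N x n \<omega>)) -` B \<inter> space M | B. True}"


section \<open>Skorokhod convergence\<close>

text \<open>
  A path on the half-line is a function on the reals of which only the values at nonnegative times
  are used.
\<close>
definition cadlag :: "(real \<Rightarrow> 'a::topological_space) \<Rightarrow> bool" where
  "cadlag f \<longleftrightarrow> (\<forall>t\<ge>0. (f \<longlongrightarrow> f t) (at_right t)) \<and> (\<forall>t>0. \<exists>l. (f \<longlongrightarrow> l) (at_left t))"

definition time_change :: "(real \<Rightarrow> real) \<Rightarrow> bool" where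
  "time_change \<mu> \<longleftrightarrow> strict_mono_on {0..} \<mu> \<and> continuous_on {0..} \<mu> \<and> \<mu> ` {0..} = {0..}"

text \<open>
  Convergence of sequences in the Skorokhod (J1) topology on the half-line; see Jacod and Shiryaev,
  Limit Theorems for Stochastic Processes, Theorem VI.1.14.
\<close>
definition skorokhod_tendsto ::
    "(nat \<Rightarrow> real \<Rightarrow> 'a::metric_space) \<Rightarrow> (real \<Rightarrow> 'a) \<Rightarrow> bool" where
  "skorokhod_tendsto f g \<longleftrightarrow>
     (\<exists>\<mu>. (\<forall>n. time_change (\<mu> n)) \<and>
          uniform_limit {0..} \<mu> (\<lambda>s. s) sequentially \<and>
          (\<forall>T\<ge>0. uniform_limit {0..T} (\<lambda>n s. f n (\<mu> n s)) g sequentially))"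

text \<open>
  The Skorokhod topology is metrizable, so accumulation points of a sequence are the limits of its
  subsequences. Only the accumulation point is required to be cadlag: the prelimit paths below are
  step functions that are left-continuous because of the ceiling function.
\<close>
definition skorokhod_accumulation_point ::
    "(nat \<Rightarrow> real \<Rightarrow> 'a::metric_space) \<Rightarrow> (real \<Rightarrow> 'a) \<Rightarrow> bool" where
  "skorokhod_accumulation_point f g \<longleftrightarrow>
     cadlag g \<and> (\<exists>r. strict_mono r \<and> skorokhod_tendsto (f \<circ> r) g)"


section \<open>Fluid limits\<close>

definition total_users :: "('v::finite \<Rightarrow> nat) \<Rightarrow> nat" where
  "total_users x = (\<Sum>k\<in>UNIV. x k)"

definition scaled_path ::
    "(('v::finite \<Rightarrow> nat) \<Rightarrow> nat \<Rightarrow> 'w \<Rightarrow> 'v \<Rightarrow> nat) \<Rightarrow> 'w \<Rightarrow> ('v \<Rightarrow> nat) \<Rightarrow> real \<Rightarrow> real ^ 'v" where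
  "scaled_path W \<omega> x t =
     (\<chi> i. real (W x (nat \<lceil>real (total_users x) * t\<rceil>) \<omega> i) / real (total_users x))"

text \<open>The realizations at the sample point \<open>\<omega>\<close> of all fluid limits.\<close>
definition fluid_limits ::
    "(('v::finite \<Rightarrow> nat) \<Rightarrow> nat \<Rightarrow> 'w \<Rightarrow> 'v \<Rightarrow> nat) \<Rightarrow> 'w \<Rightarrow> (real \<Rightarrow> real ^ 'v) set" where
  "fluid_limits W \<omega> =
     {z. \<exists>x. filterlim (\<lambda>n. total_users (x n)) at_top sequentially \<and>
             skorokhod_accumulation_point (\<lambda>n. scaled_path W \<omega> (x n)) z}"

definition fluid_model_stable ::
    "'w measure \<Rightarrow> (('v::finite \<Rightarrow> nat) \<Rightarrow> nat \<Rightarrow> 'w \<Rightarrow> 'v \<Rightarrow> nat) \<Rightarrow> bool" where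
  "fluid_model_stable M W \<longleftrightarrow>
     (\<exists>t\<^sub>0\<ge>0. AE \<omega> in M. \<forall>z\<in>fluid_limits W \<omega>. \<forall>t\<ge>t\<^sub>0. z t = 0)"

end

theory Submission
  imports Defs
begin

text \<open>
  The Lyapunov function is the Euclidean norm of the queue vector w. With
  \<open>S\<^sub>i = \<Sum>j\<in>V\<^sub>i. w\<^sub>j\<close>, \<open>p\<^sub>i = w\<^sub>i / S\<^sub>i\<close> and \<open>s\<^sub>i = \<Sum>j\<in>V\<^sub>i. p\<^sub>j\<close>, the success probability at i is about
  \<open>p\<^sub>i exp (- s\<^sub>i)\<close>. A tangent line bound for this expression, weighted by \<open>w\<^sub>i\<close> and summed over i, gives
  \<open>\<Sum>i. w\<^sub>i p\<^sub>i exp (- s\<^sub>i) \<ge> (1 / (e V)) \<Sum>i. w\<^sub>i\<close>, since \<open>\<Sum>i. w\<^sub>i s\<^sub>i = \<Sum>j. p\<^sub>j S\<^sub>j = \<Sum>j. w\<^sub>j\<close> and \<open>\<Sum>i. S\<^sub>i = V \<Sum>i. w\<^sub>i\<close>.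
  Hence the norm decreases at a linear rate if the arrival rate is less than \<open>1 / (e V)\<close>.

  The argument runs on the discrete chains, for all initial states with m users at once. The
  arrivals are shared by all chains and obey the strong law of large numbers; the departures minus
  their conditional means are a bounded martingale, so by Azuma's inequality they exceed \<open>\<epsilon> m\<close> in time O(m) with
  probability exponentially small in m, whereas there are only polynomially many initial states.
\<close>


section \<open>Strong law of large numbers\<close>

text \<open>When the square is expanded, the off-diagonal products have expectation 0 by
  independence and centring, so only the diagonal contributes.\<close>

lemma (in prob_space) second_moment_sum_indep:
  fixes Z :: "'i \<Rightarrow> 'a \<Rightarrow> real"
  assumes "finite I" and indep: "indep_vars (\<lambda>_. borel) Z I"
    and int: "\<And>i. i \<in> I \<Longrightarrow> integrable M (Z i)"
    and int2: "\<And>i. i \<in> I \<Longrightarrow> integrable M (\<lambda>\<omega>. (Z i \<omega>)\<^sup>2)"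
    and zero: "\<And>i. i \<in> I \<Longrightarrow> expectation (Z i) = 0"
  shows "integrable M (\<lambda>\<omega>. (\<Sum>i\<in>I. Z i \<omega>)\<^sup>2)"
    and "expectation (\<lambda>\<omega>. (\<Sum>i\<in>I. Z i \<omega>)\<^sup>2) = (\<Sum>i\<in>I. expectation (\<lambda>\<omega>. (Z i \<omega>)\<^sup>2))"
proof -
  have pair: "integrable M (\<lambda>\<omega>. Z i \<omega> * Z j \<omega>) \<and>
      expectation (\<lambda>\<omega>. Z i \<omega> * Z j \<omega>) = (if i = j then expectation (\<lambda>\<omega>. (Z i \<omega>)\<^sup>2) else 0)"
    if "i \<in> I" "j \<in> I" for i j
  proof (cases "i = j")
    case True
    then show ?thesis using int2[OF that(1)] by (simp add: power2_eq_square)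
  next
    case False
    have ind: "indep_vars (\<lambda>_. borel) Z {i, j}"
      using indep that by (rule_tac indep_vars_subset) auto
    have "integrable M (\<lambda>\<omega>. \<Prod>k\<in>{i, j}. Z k \<omega>)"
      using that int by (intro indep_vars_integrable ind) auto
    moreover have "expectation (\<lambda>\<omega>. \<Prod>k\<in>{i, j}. Z k \<omega>) = (\<Prod>k\<in>{i, j}. expectation (Z k))"
      using that int by (intro indep_vars_lebesgue_integral ind) auto
    ultimately show ?thesis using False zero[OF that(1)] by simp
  qed
  have sq: "(\<Sum>i\<in>I. Z i \<omega>)\<^sup>2 = (\<Sum>i\<in>I. \<Sum>j\<in>I. Z i \<omega> * Z j \<omega>)" for \<omega>
    by (simp add: power2_eq_square sum_product)
  show "integrable M (\<lambda>\<omega>. (\<Sum>i\<in>I. Z i \<omega>)\<^sup>2)"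
    unfolding sq using pair by (intro Bochner_Integration.integrable_sum) auto
  have "expectation (\<lambda>\<omega>. (\<Sum>i\<in>I. Z i \<omega>)\<^sup>2) = (\<Sum>i\<in>I. \<Sum>j\<in>I. expectation (\<lambda>\<omega>. Z i \<omega> * Z j \<omega>))"
    unfolding sq using pair
    by (subst Bochner_Integration.integral_sum;
        (intro Bochner_Integration.integrable_sum sum.cong refl Bochner_Integration.integral_sum)?) auto
  also have "\<dots> = (\<Sum>i\<in>I. \<Sum>j\<in>I. if i = j then expectation (\<lambda>\<omega>. (Z i \<omega>)\<^sup>2) else 0)"
    using pair by (intro sum.cong refl) auto
  also have "\<dots> = (\<Sum>i\<in>I. expectation (\<lambda>\<omega>. (Z i \<omega>)\<^sup>2))"
    using \<open>finite I\<close> by simp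
  finally show "expectation (\<lambda>\<omega>. (\<Sum>i\<in>I. Z i \<omega>)\<^sup>2) = (\<Sum>i\<in>I. expectation (\<lambda>\<omega>. (Z i \<omega>)\<^sup>2))" .
qed

text \<open>The powers of 2 below \<open>u\<close> add up to less than twice the largest of them.
  With \<open>u = U 0 \<omega>\<close> this bounds the sum over \<open>n\<close> of
  \<open>2 ^ n\<close> times the probability of \<open>U 0 > 2 ^ n\<close> by a first
  moment.\<close>

lemma sum_powers_below:
  fixes u :: real
  assumes "u \<ge> 0"
  shows "(\<Sum>n<N. 2 ^ n * of_bool (2 ^ n < u)) \<le> 2 * u"
proof -
  \<comment> \<open>The bound \<open>2 ^ N\<close> drives the induction: a new term
    \<open>2 ^ N < u\<close> raises the sum to at most \<open>2 * 2 ^ N\<close>, which is below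
    \<open>2 * u\<close>.\<close>
  have "(\<Sum>n<N. 2 ^ n * of_bool (2 ^ n < u)) \<le> min (2 ^ N) (2 * u)"
    using assms by (induction N) (auto simp: min_def split: if_splits)
  thus ?thesis by simp
qed

text \<open>A geometric series starting at the first power of 2 that is at least \<open>u\<close>
  sums to at most \<open>2 / u\<close>. This bounds the normalised second moments of the truncated
  variables, summed over all levels, by a first moment.\<close>

lemma sum_inverse_powers_above:
  fixes u :: real
  assumes "u \<ge> 0"
  shows "(\<Sum>n<N. u\<^sup>2 * of_bool (u \<le> 2 ^ n) / 2 ^ n) \<le> 2 * u"
proof (cases "u = 0")
  case False
  hence u: "u > 0" using assms by simp
  \<comment> \<open>The subtracted \<open>2 / 2 ^ N\<close> is the sum of all terms
    \<open>1 / 2 ^ n\<close> with \<open>n \<ge> N\<close> still to come; it lets the induction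
    close.\<close>
  have "(\<Sum>n<N. of_bool (u \<le> 2 ^ n) / 2 ^ n) \<le> max 0 (2 / u - 2 / 2 ^ N)"
  proof (induction N)
    case (Suc N)
    show ?case
    proof (cases "u \<le> 2 ^ N")
      case True
      hence "2 / u - 2 / 2 ^ N \<ge> 0" using u by (simp add: field_simps)
      hence "(\<Sum>n<N. of_bool (u \<le> 2 ^ n) / 2 ^ n) \<le> 2 / u - 2 * (1 / 2 ^ N)" using Suc by simp
      moreover have "(2::real) / 2 ^ Suc N = 1 / 2 ^ N" by simp
      ultimately show ?thesis using True by (simp only: sum.lessThan_Suc) simp
    next
      case False
      hence "2 / u - 2 / 2 ^ N \<le> 0" using u by (simp add: field_simps)
      thus ?thesis using Suc False by simp
    qed
  qed simp
  also have "\<dots> \<le> 2 / u" using u by simp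
  finally have "u\<^sup>2 * (\<Sum>n<N. of_bool (u \<le> 2 ^ n) / 2 ^ n) \<le> u\<^sup>2 * (2 / u)"
    by (intro mult_left_mono) auto
  thus ?thesis using u by (simp add: sum_distrib_left power2_eq_square)
qed simp

lemma (in prob_space) expectation_identically_distributed:
  fixes X Y :: "'a \<Rightarrow> real" and f :: "real \<Rightarrow> real"
  assumes [measurable]: "X \<in> borel_measurable M" "Y \<in> borel_measurable M" "f \<in> borel_measurable borel"
    and ident: "distr M borel X = distr M borel Y"
  shows "expectation (\<lambda>\<omega>. f (X \<omega>)) = expectation (\<lambda>\<omega>. f (Y \<omega>))"
    and "integrable M (\<lambda>\<omega>. f (X \<omega>)) \<longleftrightarrow> integrable M (\<lambda>\<omega>. f (Y \<omega>))"
  using integral_distr[of X M borel f] integral_distr[of Y M borel f]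
    integrable_distr_eq[of X M borel f] integrable_distr_eq[of Y M borel f] ident by simp_all

text \<open>
  Truncating all of the first \<open>2 ^ n\<close> variables at the level \<open>2 ^ n\<close> makes both error probabilities summable.
  In the strong law the dyadic bound is only applied to the part of the variables above a high
  level, whose mean is so small that the factor 2 lost between powers of 2 is harmless.
\<close>
lemma (in prob_space) iid_dyadic_sum_le:
  fixes U :: "nat \<Rightarrow> 'a \<Rightarrow> real"
  assumes indep: "indep_vars (\<lambda>_. borel) U UNIV"
    and ident: "\<And>n. distr M borel (U n) = distr M borel (U 0)"
    and int: "integrable M (U 0)" and nonneg: "\<And>n \<omega>. U n \<omega> \<ge> 0" and "\<eta> > 0"
  shows "AE \<omega> in M. eventually (\<lambda>n. (\<Sum>k<2 ^ n. U k \<omega>) \<le> 2 ^ n * (expectation (U 0) + \<eta>)) sequentially"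
proof -
  have [measurable]: "U n \<in> borel_measurable M" for n
    using indep by (auto simp: indep_vars_def)
  define \<tau> :: "nat \<Rightarrow> real \<Rightarrow> real" where "\<tau> = (\<lambda>n u. u * of_bool (u \<le> 2 ^ n))"
  have \<tau>_meas [measurable]: "\<tau> n \<in> borel_measurable borel" for n unfolding \<tau>_def by measurable
  have \<tau>_bounds: "0 \<le> \<tau> n (U k \<omega>)" "\<tau> n (U k \<omega>) \<le> 2 ^ n" "\<tau> n (U k \<omega>) \<le> U k \<omega>" for n k \<omega>
    using nonneg by (auto simp: \<tau>_def)
  have \<tau>_int: "integrable M (\<lambda>\<omega>. \<tau> n (U k \<omega>))" for n k
    using \<tau>_bounds by (intro integrable_const_bound[of _ "2 ^ n"]) auto
  define m where "m = (\<lambda>n. expectation (\<lambda>\<omega>. \<tau> n (U 0 \<omega>)))"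
  have m: "expectation (\<lambda>\<omega>. \<tau> n (U k \<omega>)) = m n" for n k
    unfolding m_def by (rule expectation_identically_distributed(1)[where f = "\<tau> n"]) (simp_all add: ident[of k])
  have m_le: "m n \<le> expectation (U 0)" for n
    unfolding m_def using int \<tau>_bounds \<tau>_int by (intro integral_mono) auto
  \<comment> \<open>\<open>A n\<close> is the event that truncation alters one of the first
    \<open>2 ^ n\<close> variables, \<open>B n\<close> that the truncated sum deviates from its mean
    by at least \<open>\<eta> * 2 ^ n\<close>. Outside both, the claimed bound holds for this
    \<open>n\<close>.\<close>
  define A where "A = (\<lambda>n. {\<omega>\<in>space M. \<exists>k\<in>{..<2 ^ n :: nat}. U k \<omega> > 2 ^ n})"
  define B where "B = (\<lambda>n. {\<omega>\<in>space M. \<bar>\<Sum>k<2 ^ n :: nat. \<tau> n (U k \<omega>) - m n\<bar> \<ge> \<eta> * 2 ^ n})"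
  have A_eq: "A n = (\<Union>k\<in>{..<2 ^ n}. {\<omega>\<in>space M. U k \<omega> > 2 ^ n})" for n
    by (auto simp: A_def)
  have A_ev: "A n \<in> events" for n
    unfolding A_eq by (intro sets.finite_UN) auto
  have B_ev: "B n \<in> events" for n
    unfolding B_def by measurable
  have A_prob: "prob (A n) \<le> expectation (\<lambda>\<omega>. 2 ^ n * of_bool (2 ^ n < U 0 \<omega>))" for n
  proof -
    have single: "prob {\<omega>\<in>space M. U k \<omega> > 2 ^ n} = expectation (\<lambda>\<omega>. of_bool (2 ^ n < U 0 \<omega>))" for k
    proof -
      have "prob {\<omega>\<in>space M. U k \<omega> > 2 ^ n} = expectation (indicator {\<omega>\<in>space M. U k \<omega> > 2 ^ n})"
        by simp
      also have "\<dots> = expectation (\<lambda>\<omega>. of_bool (2 ^ n < U k \<omega>))"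
        by (intro Bochner_Integration.integral_cong) (auto simp: indicator_def)
      also have "\<dots> = expectation (\<lambda>\<omega>. of_bool (2 ^ n < U 0 \<omega>))"
        by (rule expectation_identically_distributed(1)[where f = "\<lambda>u. of_bool (2 ^ n < u)"]) (simp_all add: ident[of k])
      finally show ?thesis .
    qed
    have "prob (A n) \<le> (\<Sum>k<2 ^ n. prob {\<omega>\<in>space M. U k \<omega> > 2 ^ n})"
      unfolding A_eq by (rule finite_measure_subadditive_finite) auto
    thus ?thesis unfolding single by simp
  qed
  have A_int: "integrable M (\<lambda>\<omega>. 2 ^ n * of_bool (2 ^ n < U 0 \<omega>) :: real)" for n
    by (intro integrable_const_bound[of _ "2 ^ n"]) auto
  have "summable (\<lambda>n. prob (A n))"
  proof (rule summableI_nonneg_bounded)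
    fix N
    have "(\<Sum>n<N. prob (A n)) \<le> (\<Sum>n<N. expectation (\<lambda>\<omega>. 2 ^ n * of_bool (2 ^ n < U 0 \<omega>)))"
      by (intro sum_mono A_prob)
    also have "\<dots> = expectation (\<lambda>\<omega>. \<Sum>n<N. 2 ^ n * of_bool (2 ^ n < U 0 \<omega>))"
      by (subst Bochner_Integration.integral_sum) (rule A_int refl)+
    also have "\<dots> \<le> expectation (\<lambda>\<omega>. 2 * U 0 \<omega>)"
    proof (rule integral_mono)
      show "integrable M (\<lambda>\<omega>. \<Sum>n<N. 2 ^ n * of_bool (2 ^ n < U 0 \<omega>) :: real)"
        by (rule Bochner_Integration.integrable_sum) (rule A_int)
      show "integrable M (\<lambda>\<omega>. 2 * U 0 \<omega>)" using int by simp
      show "(\<Sum>n<N. 2 ^ n * of_bool (2 ^ n < U 0 \<omega>)) \<le> 2 * U 0 \<omega>" for \<omega>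
        by (rule sum_powers_below[OF nonneg])
    qed
    finally show "(\<Sum>n<N. prob (A n)) \<le> expectation (\<lambda>\<omega>. 2 * U 0 \<omega>)" .
  qed simp
  hence AE_A: "AE \<omega> in M. eventually (\<lambda>n. \<omega> \<in> space M - A n) sequentially"
    by (intro borel_cantelli_AE1 A_ev) (auto simp: less_top[symmetric])
  have \<tau>2_int: "integrable M (\<lambda>\<omega>. (\<tau> n (U 0 \<omega>))\<^sup>2)" for n
  proof (rule integrable_const_bound[of _ "2 ^ n * 2 ^ n"])
    have "(\<tau> n (U 0 \<omega>))\<^sup>2 \<le> 2 ^ n * 2 ^ n" for \<omega>
      unfolding power2_eq_square using \<tau>_bounds by (intro mult_mono) auto
    thus "AE \<omega> in M. norm ((\<tau> n (U 0 \<omega>))\<^sup>2) \<le> 2 ^ n * 2 ^ n" by simp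
  qed measurable
  have B_prob: "prob (B n) \<le> expectation (\<lambda>\<omega>. (\<tau> n (U 0 \<omega>))\<^sup>2 / 2 ^ n) / \<eta>\<^sup>2" for n
  proof -
    let ?Z = "\<lambda>k \<omega>. \<tau> n (U k \<omega>) - m n"
    have Z: "indep_vars (\<lambda>_. borel) ?Z {..<2 ^ n}"
      by (rule indep_vars_compose2[OF indep_vars_subset[OF indep], of _ "\<lambda>_ u. \<tau> n u - m n"]) auto
    have m0: "0 \<le> m n" "m n \<le> 2 ^ n"
      unfolding m_def using \<tau>_bounds \<tau>_int by (auto intro!: integral_nonneg_AE integral_le_const)
    have Zb: "\<bar>?Z k \<omega>\<bar> \<le> 2 ^ n" for k \<omega>
      using m0 \<tau>_bounds[of n k \<omega>] by (auto simp: abs_le_iff)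
    have Zint: "integrable M (?Z k)" for k
      using \<tau>_int by auto
    have Zint2: "integrable M (\<lambda>\<omega>. (?Z k \<omega>)\<^sup>2)" for k
      using Zb by (intro integrable_const_bound[of _ "(2 ^ n)\<^sup>2"] AE_I2) (auto simp: abs_le_square_iff[symmetric])
    have Z0: "expectation (?Z k) = 0" for k
      using m \<tau>_int by (simp add: prob_space)
    note S = second_moment_sum_indep[OF finite_lessThan Z Zint Zint2 Z0]
    have var: "expectation (\<lambda>\<omega>. (?Z k \<omega>)\<^sup>2) \<le> expectation (\<lambda>\<omega>. (\<tau> n (U 0 \<omega>))\<^sup>2)" for k
    proof -
      have "expectation (\<lambda>\<omega>. (?Z k \<omega>)\<^sup>2) = expectation (\<lambda>\<omega>. (?Z 0 \<omega>)\<^sup>2)"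
        by (rule expectation_identically_distributed(1)[where f = "\<lambda>u. (\<tau> n u - m n)\<^sup>2"]) (simp_all add: ident[of k])
      also have "\<dots> = expectation (\<lambda>\<omega>. (\<tau> n (U 0 \<omega>))\<^sup>2) - (m n)\<^sup>2"
        unfolding m_def using \<tau>_int \<tau>2_int by (intro variance_eq)
      finally show ?thesis by simp
    qed
    \<comment> \<open>Chebyshev's inequality: \<open>2 ^ n\<close> variances are divided by
      \<open>(\<eta> * 2 ^ n)\<^sup>2\<close>, which leaves the factor \<open>1 / 2 ^ n\<close> that
      \<open>sum_inverse_powers_above\<close> expects.\<close>
    have "prob (B n) \<le> expectation (\<lambda>\<omega>. (\<Sum>k<2 ^ n. ?Z k \<omega>)\<^sup>2) / (\<eta> * 2 ^ n)\<^sup>2"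
      unfolding B_def using \<open>\<eta> > 0\<close> by (intro second_moment_method S) auto
    also have "\<dots> \<le> (2 ^ n * expectation (\<lambda>\<omega>. (\<tau> n (U 0 \<omega>))\<^sup>2)) / (\<eta> * 2 ^ n)\<^sup>2"
    proof (intro divide_right_mono)
      have "(\<Sum>k<2 ^ n. expectation (\<lambda>\<omega>. (?Z k \<omega>)\<^sup>2)) \<le>
          (\<Sum>k<(2 ^ n :: nat). expectation (\<lambda>\<omega>. (\<tau> n (U 0 \<omega>))\<^sup>2))"
        by (intro sum_mono var)
      thus "expectation (\<lambda>\<omega>. (\<Sum>k<2 ^ n. ?Z k \<omega>)\<^sup>2) \<le> 2 ^ n * expectation (\<lambda>\<omega>. (\<tau> n (U 0 \<omega>))\<^sup>2)"
        unfolding S(2) by simp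
    qed simp
    also have "\<dots> = expectation (\<lambda>\<omega>. (\<tau> n (U 0 \<omega>))\<^sup>2 / 2 ^ n) / \<eta>\<^sup>2"
      by (simp add: power_mult_distrib power2_eq_square)
    finally show ?thesis .
  qed
  have "summable (\<lambda>n. prob (B n))"
  proof (rule summableI_nonneg_bounded)
    fix N
    have "(\<Sum>n<N. prob (B n)) \<le> (\<Sum>n<N. expectation (\<lambda>\<omega>. (\<tau> n (U 0 \<omega>))\<^sup>2 / 2 ^ n) / \<eta>\<^sup>2)"
      by (intro sum_mono B_prob)
    also have "\<dots> = expectation (\<lambda>\<omega>. \<Sum>n<N. (\<tau> n (U 0 \<omega>))\<^sup>2 / 2 ^ n) / \<eta>\<^sup>2"
      using \<tau>2_int by (subst Bochner_Integration.integral_sum) (simp_all add: sum_divide_distrib)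
    also have "\<dots> \<le> expectation (\<lambda>\<omega>. 2 * U 0 \<omega>) / \<eta>\<^sup>2"
    proof (intro divide_right_mono integral_mono)
      have "(\<tau> n u)\<^sup>2 = u\<^sup>2 * of_bool (u \<le> 2 ^ n)" for n u by (simp add: \<tau>_def of_bool_def)
      thus "(\<Sum>n<N. (\<tau> n (U 0 \<omega>))\<^sup>2 / 2 ^ n) \<le> 2 * U 0 \<omega>" for \<omega>
        using sum_inverse_powers_above[OF nonneg, where N = N] by simp
      show "integrable M (\<lambda>\<omega>. \<Sum>n<N. (\<tau> n (U 0 \<omega>))\<^sup>2 / 2 ^ n)"
        using \<tau>2_int by simp
    qed (use int in simp_all)
    finally show "(\<Sum>n<N. prob (B n)) \<le> expectation (\<lambda>\<omega>. 2 * U 0 \<omega>) / \<eta>\<^sup>2" .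
  qed simp
  hence AE_B: "AE \<omega> in M. eventually (\<lambda>n. \<omega> \<in> space M - B n) sequentially"
    by (intro borel_cantelli_AE1 B_ev) (auto simp: less_top[symmetric])
  from AE_A AE_B show ?thesis
  proof eventually_elim
    case (elim \<omega>)
    from elim show ?case
    proof eventually_elim
      case (elim n)
      have "U k \<omega> = \<tau> n (U k \<omega>)" if "k < 2 ^ n" for k
        using elim(1) that by (auto simp: A_def \<tau>_def not_less)
      hence "(\<Sum>k<2 ^ n. U k \<omega>) = (\<Sum>k<2 ^ n. \<tau> n (U k \<omega>) - m n) + 2 ^ n * m n"
        by (simp add: sum_subtractf)
      also have "\<dots> \<le> \<eta> * 2 ^ n + 2 ^ n * expectation (U 0)"
        using elim(2) m_le[of n] by (intro add_mono mult_left_mono) (auto simp: B_def)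
      finally show ?case by (simp add: algebra_simps)
    qed
  qed
qed

text \<open>Hoeffding's bound is geometric in \<open>n\<close>, so Borel-Cantelli applies along the
  full sequence and not only along powers of 2.\<close>

lemma (in prob_space) iid_bounded_sum_close:
  fixes X :: "nat \<Rightarrow> 'a \<Rightarrow> real"
  assumes indep: "indep_vars (\<lambda>_. borel) X UNIV"
    and ident: "\<And>n. distr M borel (X n) = distr M borel (X 0)"
    and bounds: "\<And>n \<omega>. X n \<omega> \<in> {0..L}" and "L > 0" and "\<epsilon> > 0"
  shows "AE \<omega> in M. eventually (\<lambda>n. \<bar>(\<Sum>k<n. X k \<omega>) - real n * expectation (X 0)\<bar> \<le> \<epsilon> * real n) sequentially"
proof -
  have [measurable]: "X n \<in> borel_measurable M" for n
    using indep by (auto simp: indep_vars_def)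
  define B where "B = (\<lambda>n. {\<omega>\<in>space M. \<bar>(\<Sum>k<n. X k \<omega>) - real n * expectation (X 0)\<bar> \<ge> \<epsilon> * real n})"
  have [measurable]: "B n \<in> events" for n unfolding B_def by measurable
  have prob: "prob (B n) \<le> 2 * exp (-2 * \<epsilon>\<^sup>2 / L\<^sup>2) ^ n" if "n > 0" for n
  proof -
    have mean: "expectation (X k) = expectation (X 0)" for k
      by (rule expectation_identically_distributed(1)[where f = "\<lambda>u. u"]) (simp_all add: ident[of k])
    interpret Hoeffding_ineq M "{..<n}" X "\<lambda>_. 0" "\<lambda>_. L" "real n * expectation (X 0)"
    proof unfold_locales
      show "indep_vars (\<lambda>_. borel) X {..<n}" using indep by (rule indep_vars_subset) auto
      show "AE \<omega> in M. X k \<omega> \<in> {0..L}" for k by (intro AE_I2 bounds)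
      have "real n * expectation (X 0) = (\<Sum>k<n. expectation (X k))"
        by (subst sum.cong[OF refl mean]) simp_all
      thus "real n * expectation (X 0) \<equiv> \<Sum>k<n. expectation (X k)" by (rule eq_reflection)
    qed simp
    have "prob (B n) \<le> 2 * exp (-2 * (\<epsilon> * real n)\<^sup>2 / (real n * L\<^sup>2))"
      using Hoeffding_ineq_abs_ge[of "\<epsilon> * real n"] that \<open>\<epsilon> > 0\<close> \<open>L > 0\<close> by (simp add: B_def)
    also have "-2 * (\<epsilon> * real n)\<^sup>2 / (real n * L\<^sup>2) = real n * (-2 * \<epsilon>\<^sup>2 / L\<^sup>2)"
      using that by (simp add: power2_eq_square)
    finally show ?thesis by (simp only: exp_of_nat_mult)
  qed
  have "summable (\<lambda>n. prob (B n))"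
  proof (rule summable_comparison_test_ev)
    show "eventually (\<lambda>n. norm (prob (B n)) \<le> 2 * exp (-2 * \<epsilon>\<^sup>2 / L\<^sup>2) ^ n) sequentially"
      using eventually_gt_at_top[of 0] by eventually_elim (use prob in auto)
    show "summable (\<lambda>n. 2 * exp (-2 * \<epsilon>\<^sup>2 / L\<^sup>2) ^ n)"
      using \<open>\<epsilon> > 0\<close> \<open>L > 0\<close> by (intro summable_mult summable_geometric) simp
  qed
  hence "AE \<omega> in M. eventually (\<lambda>n. \<omega> \<in> space M - B n) sequentially"
    by (intro borel_cantelli_AE1) (auto simp: less_top[symmetric])
  thus ?thesis
    by eventually_elim (auto simp: B_def elim!: eventually_mono)
qed

text \<open>By nonnegativity the sum up to \<open>n\<close> is at most the sum up to the next power
  of 2, which itself is at most \<open>2 * n\<close>; hence the factor 2.\<close>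

lemma dyadic_to_all:
  fixes u :: "nat \<Rightarrow> real"
  assumes nonneg: "\<And>k. u k \<ge> 0" and "c \<ge> 0"
    and dyadic: "eventually (\<lambda>n. (\<Sum>k<2 ^ n. u k) \<le> 2 ^ n * c) sequentially"
  shows "eventually (\<lambda>n. (\<Sum>k<n. u k) \<le> 2 * c * real n) sequentially"
proof -
  from dyadic obtain N where N: "\<And>n. n \<ge> N \<Longrightarrow> (\<Sum>k<2 ^ n. u k) \<le> 2 ^ n * c"
    by (auto simp: eventually_sequentially)
  have "(\<Sum>k<n. u k) \<le> 2 * c * real n" if "n \<ge> 2 ^ N" for n
  proof -
    have "n \<ge> 1" using that by (meson dual_order.trans one_le_numeral one_le_power)
    then obtain j where j: "2 ^ j \<le> n" "n < 2 ^ (j + 1)"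
      using ex_power_ivl1[of 2 n] by auto
    have "(2::nat) ^ N < 2 ^ (j + 1)" using that j by simp
    hence "N < j + 1" by (rule power_less_imp_less_exp[rotated]) simp
    hence "N \<le> j + 1" by simp
    have "(\<Sum>k<n. u k) \<le> (\<Sum>k<2 ^ (j + 1). u k)"
      using j nonneg by (intro sum_mono2) auto
    also have "\<dots> \<le> 2 ^ (j + 1) * c" by (intro N) fact
    also have "\<dots> = 2 * c * 2 ^ j" by simp
    also have "\<dots> \<le> 2 * c * real n"
      using j(1) \<open>c \<ge> 0\<close> by (intro mult_left_mono) (auto simp: numeral_power_le_of_nat_cancel_iff)
    finally show ?thesis .
  qed
  thus ?thesis by (auto simp: eventually_sequentially)
qed

text \<open>The arrivals are only assumed integrable, so no variance is available. Cutting at a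
  level \<open>L\<close> leaves a bounded part, controlled by Hoeffding's inequality, and a
  nonnegative excess of mean at most \<open>\<epsilon>\<close>, controlled by the dyadic
  bound.\<close>

theorem (in prob_space) strong_law_nonneg:
  fixes X :: "nat \<Rightarrow> 'a \<Rightarrow> real"
  assumes indep: "indep_vars (\<lambda>_. borel) X UNIV"
    and ident: "\<And>n. distr M borel (X n) = distr M borel (X 0)"
    and int: "integrable M (X 0)" and nonneg: "\<And>n \<omega>. X n \<omega> \<ge> 0"
  shows "AE \<omega> in M. (\<lambda>n. (\<Sum>k<n. X k \<omega>) / real n) \<longlonglongrightarrow> expectation (X 0)"
proof -
  have [measurable]: "X n \<in> borel_measurable M" for n
    using indep by (auto simp: indep_vars_def)
  \<comment> \<open>Of the factor 6, one \<open>\<epsilon>\<close> is for the bounded part, four are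
    for the excess (\<open>2 * (\<epsilon> + \<epsilon>)\<close>) and one is for the mean of the
    excess.\<close>
  have close: "AE \<omega> in M. eventually (\<lambda>n. \<bar>(\<Sum>k<n. X k \<omega>) - real n * expectation (X 0)\<bar> \<le> 6 * \<epsilon> * real n) sequentially"
    if "\<epsilon> > 0" for \<epsilon>
  proof -
    have "(\<lambda>L. expectation (\<lambda>\<omega>. min (X 0 \<omega>) (real L))) \<longlonglongrightarrow> expectation (X 0)"
    proof (rule integral_dominated_convergence[where w = "X 0"])
      show "AE \<omega> in M. (\<lambda>L. min (X 0 \<omega>) (real L)) \<longlonglongrightarrow> X 0 \<omega>"
      proof (intro AE_I2 tendsto_eventually)
        fix \<omega>
        show "eventually (\<lambda>L. min (X 0 \<omega>) (real L) = X 0 \<omega>) sequentially"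
          using eventually_ge_at_top[of "nat \<lceil>X 0 \<omega>\<rceil>"] by eventually_elim linarith
      qed
    qed (use int nonneg in auto)
    hence "eventually (\<lambda>L. expectation (\<lambda>\<omega>. min (X 0 \<omega>) (real L)) > expectation (X 0) - \<epsilon>) sequentially"
      using \<open>\<epsilon> > 0\<close> by (intro order_tendstoD(1)) auto
    hence "eventually (\<lambda>L. L > 0 \<and> expectation (\<lambda>\<omega>. min (X 0 \<omega>) (real L)) > expectation (X 0) - \<epsilon>) sequentially"
      using eventually_gt_at_top[of 0] by eventually_elim auto
    then obtain L :: nat where L: "L > 0" "expectation (\<lambda>\<omega>. min (X 0 \<omega>) (real L)) > expectation (X 0) - \<epsilon>"
      using eventually_happens'[OF sequentially_bot] by blast
    define Y where "Y = (\<lambda>n \<omega>. min (X n \<omega>) (real L))"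
    define U where "U = (\<lambda>n \<omega>. X n \<omega> - min (X n \<omega>) (real L))"
    have Y: "indep_vars (\<lambda>_. borel) Y UNIV"
      unfolding Y_def by (rule indep_vars_compose2[OF indep, of "\<lambda>_ x. min x (real L)"]) auto
    have U: "indep_vars (\<lambda>_. borel) U UNIV"
      unfolding U_def by (rule indep_vars_compose2[OF indep, of "\<lambda>_ x. x - min x (real L)"]) auto
    have f_ident: "distr M borel (\<lambda>\<omega>. f (X n \<omega>)) = distr M borel (\<lambda>\<omega>. f (X 0 \<omega>))"
      if [measurable]: "f \<in> borel_measurable borel" for f :: "real \<Rightarrow> real" and n
      using distr_distr[of f borel borel "X n" M] distr_distr[of f borel borel "X 0" M] ident[of n]
      by (simp add: o_def)
    have Yid: "distr M borel (Y n) = distr M borel (Y 0)" for n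
      unfolding Y_def by (rule f_ident) measurable
    have Uid: "distr M borel (U n) = distr M borel (U 0)" for n
      unfolding U_def by (rule f_ident) measurable
    have Yint: "integrable M (Y 0)"
      unfolding Y_def using nonneg by (intro integrable_const_bound[of _ "real L"]) auto
    have Uint: "integrable M (U 0)" using int Yint unfolding U_def Y_def by auto
    have EU: "expectation (U 0) = expectation (X 0) - expectation (Y 0)"
      unfolding U_def Y_def using int Yint[unfolded Y_def] by simp
    have U0: "U n \<omega> \<ge> 0" for n \<omega> by (simp add: U_def)
    have EUb: "0 \<le> expectation (U 0)" "expectation (U 0) \<le> \<epsilon>"
    proof -
      show "0 \<le> expectation (U 0)" by (intro integral_nonneg_AE AE_I2 U0)
      show "expectation (U 0) \<le> \<epsilon>" using L(2) by (simp add: EU Y_def)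
    qed
    have "AE \<omega> in M. eventually (\<lambda>n. \<bar>(\<Sum>k<n. Y k \<omega>) - real n * expectation (Y 0)\<bar> \<le> \<epsilon> * real n) sequentially"
      by (rule iid_bounded_sum_close[OF Y Yid _ _ \<open>\<epsilon> > 0\<close>, of "real L"]) (use nonneg L in \<open>auto simp: Y_def\<close>)
    moreover have "AE \<omega> in M. eventually (\<lambda>n. (\<Sum>k<2 ^ n. U k \<omega>) \<le> 2 ^ n * (expectation (U 0) + \<epsilon>)) sequentially"
      by (rule iid_dyadic_sum_le[OF U Uid Uint U0 \<open>\<epsilon> > 0\<close>])
    ultimately show ?thesis
    proof eventually_elim
      case (elim \<omega>)
      have "eventually (\<lambda>n. (\<Sum>k<n. U k \<omega>) \<le> 2 * (expectation (U 0) + \<epsilon>) * real n) sequentially"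
        using EUb \<open>\<epsilon> > 0\<close> by (intro dyadic_to_all elim U0) auto
      with elim(1) show ?case
      proof eventually_elim
        case (elim n)
        have "(\<Sum>k<n. U k \<omega>) = (\<Sum>k<n. X k \<omega>) - (\<Sum>k<n. Y k \<omega>)"
          by (simp add: sum_subtractf U_def Y_def)
        hence "(\<Sum>k<n. X k \<omega>) - real n * expectation (X 0) =
           ((\<Sum>k<n. Y k \<omega>) - real n * expectation (Y 0)) + (\<Sum>k<n. U k \<omega>) - real n * expectation (U 0)"
          by (simp add: EU algebra_simps)
        moreover have "0 \<le> (\<Sum>k<n. U k \<omega>)" using U0 by (intro sum_nonneg)
        moreover have "(\<Sum>k<n. U k \<omega>) \<le> 4 * \<epsilon> * real n"
          using elim(2) mult_right_mono[of "2 * (expectation (U 0) + \<epsilon>)" "4 * \<epsilon>" "real n"] EUb by simp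
        moreover have "0 \<le> real n * expectation (U 0)" "real n * expectation (U 0) \<le> \<epsilon> * real n"
          using EUb mult_right_mono[of "expectation (U 0)" \<epsilon> "real n"] by (auto simp: mult.commute)
        ultimately show ?case using elim(1) by linarith
      qed
    qed
  qed
  \<comment> \<open>The exceptional null set depends on \<open>\<epsilon>\<close>, so only the
    countably many values \<open>1 / real (Suc j)\<close> are used.\<close>
  have "AE \<omega> in M. \<forall>j::nat. eventually (\<lambda>n. \<bar>(\<Sum>k<n. X k \<omega>) - real n * expectation (X 0)\<bar>
      \<le> 6 * (1 / real (Suc j)) * real n) sequentially"
    unfolding AE_all_countable by (intro allI close) simp
  thus ?thesis
  proof eventually_elim
    case (elim \<omega>)
    show ?case
    proof (rule LIMSEQ_I)
      fix r :: real assume "r > 0"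
      then obtain j where j: "1 / real (Suc j) < r / 6"
        using nat_approx_posE[of "r / 6"] by auto
      have "eventually (\<lambda>n. norm ((\<Sum>k<n. X k \<omega>) / real n - expectation (X 0)) < r) sequentially"
        using elim[rule_format, of j] eventually_gt_at_top[of 0]
      proof eventually_elim
        case (elim n)
        have "(\<Sum>k<n. X k \<omega>) / real n - expectation (X 0) =
            ((\<Sum>k<n. X k \<omega>) - real n * expectation (X 0)) / real n"
          using elim(2) by (simp add: diff_divide_distrib)
        hence "norm ((\<Sum>k<n. X k \<omega>) / real n - expectation (X 0)) =
            \<bar>(\<Sum>k<n. X k \<omega>) - real n * expectation (X 0)\<bar> / real n"
          by (simp add: abs_divide)
        also have "\<dots> \<le> 6 * (1 / real (Suc j))"
          using elim by (simp add: field_simps)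
        also have "\<dots> < r" using j by simp
        finally show ?case .
      qed
      thus "\<exists>n0. \<forall>n\<ge>n0. norm ((\<Sum>k<n. X k \<omega>) / real n - expectation (X 0)) < r"
        by (simp add: eventually_sequentially)
    qed
  qed
qed


section \<open>Drift of the queue vector\<close>

text \<open>Combines \<open>ln y \<ge> 1 - 1 / y\<close> for \<open>y = v * p\<close> with
  \<open>exp z \<ge> 1 + z\<close>. Equality holds at \<open>p = 1 / v\<close>,
  \<open>s = 1\<close>, the values for equal queues when \<open>v\<close> is the neighbourhood size.
  The bound is linear in \<open>s\<close> and \<open>1 / p\<close>, so its weighted sum can be
  computed exactly.\<close>

lemma tangent_bound:
  fixes p s v :: real
  assumes "p > 0" "v > 0"
  shows "p * exp (- s) \<ge> exp (- 1) / v * (3 - s - 1 / (v * p))"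
proof -
  define y where "y = v * p"
  have y: "y > 0" using assms by (simp add: y_def)
  have "ln y \<ge> 1 - 1 / y"
    using ln_le_minus_one[of "1 / y"] y by (simp add: ln_div)
  hence "3 - s - 1 / y \<le> 1 + (ln y + 1 - s)" by simp
  also have "\<dots> \<le> exp (ln y + 1 - s)" by (rule exp_ge_add_one_self)
  also have "\<dots> = y * exp (1 - s)" using y by (simp add: exp_add[symmetric] exp_diff exp_add)
  finally have "exp (-1) / v * (3 - s - 1 / y) \<le> exp (-1) / v * (y * exp (1 - s))"
    using assms by (intro mult_left_mono) auto
  also have "\<dots> = p * exp (- s)"
    using assms by (simp add: y_def exp_diff exp_minus field_simps)
  finally show ?thesis by (simp add: y_def)
qed

text \<open>The logarithm of \<open>1 - 1 / s\<close> is at least \<open>- 1 / (s - 1)\<close>, and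
  \<open>w / (s - 1)\<close> exceeds \<open>w / s\<close> by \<open>(w / s) * (1 / (s - 1))\<close>,
  which is at most \<open>1 / b\<close> since \<open>w \<le> s\<close> and
  \<open>b \<le> s - 1\<close>.\<close>

lemma one_minus_inverse_power_ge:
  fixes w s b :: nat
  assumes "w \<le> s" "b < s" "0 < b"
  shows "(1 - 1 / real s) ^ w \<ge> exp (- (real w / real s) - 1 / real b)"
proof -
  have s: "real s > 1" "real b \<le> real s - 1" "real b > 0" using assms by linarith+
  have pos: "1 - 1 / real s > 0" using s by simp
  have "ln (1 - 1 / real s) = - ln (1 / (1 - 1 / real s))"
    using pos by (simp add: ln_div)
  also have "1 / (1 - 1 / real s) = 1 + 1 / (real s - 1)"
    using s by (simp add: field_simps)
  also have "- ln \<dots> \<ge> - (1 / (real s - 1))"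
    using ln_add_one_self_le_self[of "1 / (real s - 1)"] s by simp
  finally have "real w * ln (1 - 1 / real s) \<ge> real w * (- (1 / (real s - 1)))"
    by (intro mult_left_mono) auto
  moreover have "real w * (1 / (real s - 1)) \<le> real w / real s + 1 / real b"
  proof -
    have "real w / (real s - 1) = real w / real s + (real w / real s) * (1 / (real s - 1))"
      using s by (simp add: divide_simps) (simp add: algebra_simps)
    also have "(real w / real s) * (1 / (real s - 1)) \<le> 1 * (1 / real b)"
      using s assms by (intro mult_mono divide_left_mono) (auto simp: field_simps)
    finally show ?thesis by simp
  qed
  ultimately have "exp (- (real w / real s) - 1 / real b) \<le> exp (real w * ln (1 - 1 / real s))"
    by simp
  also have "\<dots> = (1 - 1 / real s) ^ w"
    using pos by (simp add: exp_of_nat_mult)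
  finally show ?thesis .
qed

section \<open>Success probabilities and the drift inequality\<close>

definition success_event :: "('v \<times> 'v) set \<Rightarrow> 'v \<Rightarrow> ('v \<Rightarrow> nat) set" where
  "success_event E i = {y. y i = 1 \<and> (\<forall>j\<in>closed_nbhd E i - {i}. y j = 0)}"

definition success_prob :: "('v::finite \<times> 'v) set \<Rightarrow> ('v \<Rightarrow> nat) \<Rightarrow> 'v \<Rightarrow> real" where
  "success_prob E w i = measure_pmf.prob (attempts_pmf E w) (success_event E i)"

lemma success_prob_bounds: "0 \<le> success_prob E w i" "success_prob E w i \<le> 1"
  by (simp_all add: success_prob_def)

text \<open>Independence makes the success probability a product of binomial masses. Vertex
  \<open>i\<close> itself contributes the exponent \<open>w i - 1\<close>; increasing it to
  \<open>w i\<close> only lowers the value and gives a product over the whole closed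
  neighbourhood.\<close>

lemma success_prob_ge:
  fixes E :: "('v::finite \<times> 'v) set" and w :: "'v \<Rightarrow> nat"
  defines "S \<equiv> \<lambda>i. \<Sum>j\<in>closed_nbhd E i. w j"
  assumes "sym E" and w: "w i > 0"
  shows "success_prob E w i \<ge>
           real (w i) / real (S i) * (\<Prod>j\<in>closed_nbhd E i. (1 - 1 / real (S j)) ^ w j)"
proof -
  \<comment> \<open>By symmetry of \<open>E\<close> the users at \<open>i\<close> are counted in
    \<open>S j\<close> for every \<open>j\<close> in its neighbourhood, so
    \<open>1 / real (S j)\<close> is a valid binomial parameter.\<close>
  have S: "S j \<ge> 1" if "j \<in> closed_nbhd E i" for j
  proof -
    have "i \<in> closed_nbhd E j" using that \<open>sym E\<close> by (auto simp: closed_nbhd_def dest: symD)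
    hence "w i \<le> S j" unfolding S_def by (intro member_le_sum) auto
    thus ?thesis using w by simp
  qed
  \<comment> \<open>Vertices outside the neighbourhood are unconstrained and contribute the factor
    1.\<close>
  let ?B = "\<lambda>j. if j = i then {1 :: nat} else if j \<in> closed_nbhd E i then {0} else UNIV"
  let ?b = "\<lambda>j. binomial_pmf (w j) (1 / real (S j))"
  have i: "i \<in> closed_nbhd E i" by (simp add: closed_nbhd_def)
  have p: "1 / real (S j) \<in> {0..1}" if "j \<in> closed_nbhd E i" for j
    using S[OF that] by auto
  have "success_event E i = PiE_dflt UNIV 0 ?B"
    using i by (auto simp: success_event_def PiE_dflt_def split: if_splits)
  hence "success_prob E w i = measure_pmf.prob (Pi_pmf UNIV 0 ?b) (PiE_dflt UNIV 0 ?B)"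
    by (simp only: success_prob_def attempts_pmf_def S_def)
  also have "\<dots> = (\<Prod>j\<in>UNIV. measure_pmf.prob (?b j) (?B j))"
    by (rule measure_Pi_pmf_PiE_dflt) simp
  also have "\<dots> = (\<Prod>j\<in>closed_nbhd E i. measure_pmf.prob (?b j) (?B j))"
    using i by (intro prod.mono_neutral_right) (auto simp: measure_pmf.prob_space[simplified])
  also have "\<dots> = measure_pmf.prob (?b i) (?B i) *
                   (\<Prod>j\<in>closed_nbhd E i - {i}. measure_pmf.prob (?b j) (?B j))"
    using i by (intro prod.remove) auto
  also have "(\<Prod>j\<in>closed_nbhd E i - {i}. measure_pmf.prob (?b j) (?B j)) =
             (\<Prod>j\<in>closed_nbhd E i - {i}. (1 - 1 / real (S j)) ^ w j)"
    using p by (intro prod.cong) (auto simp: measure_pmf_single pmf_binomial)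
  also have "measure_pmf.prob (?b i) (?B i) =
      real (w i) / real (S i) * (1 - 1 / real (S i)) ^ (w i - 1)"
    using p[OF i] by (simp add: measure_pmf_single pmf_binomial)
  also have "\<dots> * (\<Prod>j\<in>closed_nbhd E i - {i}. (1 - 1 / real (S j)) ^ w j) \<ge>
     real (w i) / real (S i) * (1 - 1 / real (S i)) ^ w i *
       (\<Prod>j\<in>closed_nbhd E i - {i}. (1 - 1 / real (S j)) ^ w j)"
    using p i by (intro mult_right_mono mult_left_mono power_decreasing prod_nonneg) auto
  also have "real (w i) / real (S i) * (1 - 1 / real (S i)) ^ w i *
       (\<Prod>j\<in>closed_nbhd E i - {i}. (1 - 1 / real (S j)) ^ w j) =
     real (w i) / real (S i) * (\<Prod>j\<in>closed_nbhd E i. (1 - 1 / real (S j)) ^ w j)"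
    by (simp add: prod.remove[OF _ i] mult.assoc)
  finally show ?thesis .
qed

lemma sum_closed_nbhd_swap:
  fixes E :: "('v::finite \<times> 'v) set" and f :: "'v \<Rightarrow> 'v \<Rightarrow> real"
  assumes "sym E"
  shows "(\<Sum>i\<in>UNIV. \<Sum>j\<in>closed_nbhd E i. f i j) = (\<Sum>j\<in>UNIV. \<Sum>i\<in>closed_nbhd E j. f i j)"
proof -
  have "{i. j \<in> closed_nbhd E i} = closed_nbhd E j" for j
    using assms by (auto simp: closed_nbhd_def dest: symD)
  thus ?thesis
    using sum.swap_restrict[of UNIV UNIV f "\<lambda>i j. j \<in> closed_nbhd E i"] by simp
qed

text \<open>By \<open>tangent_bound\<close> with \<open>v = V\<close>, the summand for
  \<open>i\<close> is at least \<open>exp (-1) / V\<close> times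
  \<open>3 * w i - w i * s i - S i / V\<close>. The sums of \<open>w i * s i\<close> and of
  \<open>S i / V\<close> both equal the total number of users by double counting, so
  \<open>3 - 1 - 1\<close> leaves it once.\<close>

lemma gibbs_drift:
  fixes E :: "('v::finite \<times> 'v) set" and w :: "'v \<Rightarrow> nat"
  defines "S \<equiv> \<lambda>i. \<Sum>j\<in>closed_nbhd E i. w j"
  defines "s \<equiv> \<lambda>i. \<Sum>j\<in>closed_nbhd E i. real (w j) / real (S j)"
  assumes "sym E" and V: "\<And>i. card (closed_nbhd E i) = V"
  shows "(\<Sum>i\<in>UNIV. real (w i) * (real (w i) / real (S i) * exp (- s i)))
           \<ge> exp (-1) / real V * real (total_users w)"
proof -
  have mem: "i \<in> closed_nbhd E i" for i by (simp add: closed_nbhd_def)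
  have Vpos: "real V > 0"
    using V[of undefined] mem[of undefined] by (metis card_gt_0_iff empty_iff finite of_nat_0_less_iff)
  have wS: "w j \<le> S i" if "j \<in> closed_nbhd E i" for i j
    unfolding S_def using that by (intro member_le_sum) auto
  have "real (w i) * (real (w i) / real (S i) * exp (- s i))
          \<ge> exp (-1) / real V * (3 * real (w i) - real (w i) * s i - real (S i) / real V)" for i
  proof (cases "w i = 0")
    \<comment> \<open>At an empty vertex the left side is 0 and the right side is a nonpositive
      multiple of \<open>S i\<close>.\<close>
    case True
    then show ?thesis using Vpos by simp
  next
    case False
    hence pos: "real (w i) > 0" "real (S i) > 0" using wS[OF mem[of i]] by auto
    have "real (w i) * (real (w i) / real (S i) * exp (- s i)) \<ge>
       real (w i) * (exp (-1) / real V * (3 - s i - 1 / (real V * (real (w i) / real (S i)))))"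
      using pos Vpos by (intro mult_left_mono tangent_bound) auto
    also have "real (w i) * (exp (-1) / real V * (3 - s i - 1 / (real V * (real (w i) / real (S i)))))
        = exp (-1) / real V * (3 * real (w i) - real (w i) * s i - real (S i) / real V)"
      using pos Vpos by (simp add: field_simps)
    finally show ?thesis .
  qed
  hence "(\<Sum>i\<in>UNIV. real (w i) * (real (w i) / real (S i) * exp (- s i))) \<ge>
     (\<Sum>i\<in>UNIV. exp (-1) / real V * (3 * real (w i) - real (w i) * s i - real (S i) / real V))"
    by (rule sum_mono)
  also have "(\<Sum>i\<in>UNIV. exp (-1) / real V * (3 * real (w i) - real (w i) * s i - real (S i) / real V))
     = exp (-1) / real V * (3 * (\<Sum>i\<in>UNIV. real (w i)) - (\<Sum>i\<in>UNIV. real (w i) * s i)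
          - (\<Sum>i\<in>UNIV. real (S i)) / real V)"
    by (simp only: sum_distrib_left[symmetric] sum_subtractf sum_divide_distrib[symmetric])
  also have "(\<Sum>i\<in>UNIV. real (w i) * s i) = (\<Sum>i\<in>UNIV. real (w i))"
  proof -
    have "(\<Sum>i\<in>UNIV. real (w i) * s i) =
        (\<Sum>j\<in>UNIV. \<Sum>i\<in>closed_nbhd E j. real (w i) * (real (w j) / real (S j)))"
      unfolding s_def sum_distrib_left by (rule sum_closed_nbhd_swap) fact
    also have "\<dots> = (\<Sum>j\<in>UNIV. real (S j) * (real (w j) / real (S j)))"
      by (simp add: S_def sum_distrib_right sum_divide_distrib)
    \<comment> \<open>If \<open>S j = 0\<close>, the quotient is 0 by convention, but then
      \<open>w j = 0\<close> as well because \<open>w j \<le> S j\<close>.\<close>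
    also have "\<dots> = (\<Sum>j\<in>UNIV. real (w j))"
      using wS[OF mem] by (intro sum.cong) (auto, metis le_zero_eq)
    finally show ?thesis .
  qed
  also have "(\<Sum>i\<in>UNIV. real (S i)) = real V * (\<Sum>i\<in>UNIV. real (w i))"
  proof -
    have "(\<Sum>i\<in>UNIV. real (S i)) = (\<Sum>j\<in>UNIV. \<Sum>i\<in>closed_nbhd E j. real (w j))"
      unfolding S_def of_nat_sum by (rule sum_closed_nbhd_swap) fact
    thus ?thesis by (simp add: V sum_distrib_left)
  qed
  finally show ?thesis using Vpos by (simp add: total_users_def)
qed

text \<open>Vertices with at most B users cost the additive constant; at all others every \<open>S\<^sub>j\<close> entering
  the success probability exceeds B, so that the Poisson approximation is accurate.\<close>
lemma success_drift:
  fixes E :: "('v::finite \<times> 'v) set" and w :: "'v \<Rightarrow> nat"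
  assumes "sym E" and V: "\<And>i. card (closed_nbhd E i) = V" and B: "B > 0"
  shows "(\<Sum>i\<in>UNIV. real (w i) * success_prob E w i) \<ge>
           exp (- (real V / real B)) * (exp (-1) / real V) * real (total_users w)
             - real (CARD('v) * B)"
proof -
  define S where "S = (\<lambda>i. \<Sum>j\<in>closed_nbhd E i. w j)"
  define s where "s = (\<lambda>i. \<Sum>j\<in>closed_nbhd E i. real (w j) / real (S j))"
  define h where "h = (\<lambda>i. real (w i) / real (S i) * exp (- s i))"
  have mem: "i \<in> closed_nbhd E i" for i by (simp add: closed_nbhd_def)
  have wS: "w j \<le> S i" if "j \<in> closed_nbhd E i" for i j
    unfolding S_def using that by (intro member_le_sum) auto
  have nbhd: "j \<in> closed_nbhd E i \<longleftrightarrow> i \<in> closed_nbhd E j" for i j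
    using \<open>sym E\<close> by (auto simp: closed_nbhd_def dest: symD)
  have h1: "h i \<le> 1" for i
  proof -
    have "s i \<ge> 0" unfolding s_def by (intro sum_nonneg) auto
    moreover have "real (w i) / real (S i) \<le> 1"
      using wS[OF mem[of i]] by (simp add: divide_le_eq)
    ultimately show ?thesis unfolding h_def by (intro mult_le_one) auto
  qed
  have "real (w i) * success_prob E w i \<ge> exp (- (real V / real B)) * (real (w i) * h i) - real B" for i
  proof (cases "w i > B")
    case True
    have SB: "S j > B" if "j \<in> closed_nbhd E i" for j
      using wS[of i j] nbhd[of i j] that True by simp
    \<comment> \<open>Each of the \<open>V\<close> vertices of the closed neighbourhood costs an
      error factor \<open>exp (- 1 / B)\<close>.\<close>
    have "exp (- s i - real V / real B) =
        (\<Prod>j\<in>closed_nbhd E i. exp (- (real (w j) / real (S j)) - 1 / real B))"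
      by (simp add: exp_sum[symmetric] sum_subtractf sum_negf s_def V)
    also have "\<dots> \<le> (\<Prod>j\<in>closed_nbhd E i. (1 - 1 / real (S j)) ^ w j)"
      using SB wS[OF mem] B by (intro prod_mono conjI one_minus_inverse_power_ge) auto
    finally have "real (w i) / real (S i) * exp (- s i - real V / real B) \<le> 
       real (w i) / real (S i) * (\<Prod>j\<in>closed_nbhd E i. (1 - 1 / real (S j)) ^ w j)"
      by (intro mult_left_mono) auto
    also have "\<dots> \<le> success_prob E w i"
      unfolding S_def using True by (intro success_prob_ge \<open>sym E\<close>) auto
    finally have "exp (- (real V / real B)) * h i \<le> success_prob E w i"
      by (simp add: h_def exp_diff exp_minus field_simps)
    hence "real (w i) * (exp (- (real V / real B)) * h i) \<le> real (w i) * success_prob E w i"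
      by (intro mult_left_mono) auto
    thus ?thesis by (simp add: algebra_simps)
  next
    case False
    \<comment> \<open>Since \<open>w i \<le> B\<close> and \<open>h i \<le> 1\<close>, subtracting
      \<open>B\<close> makes the lower bound nonpositive.\<close>
    have "exp (- (real V / real B)) * (real (w i) * h i) \<le> 1 * (real B * 1)"
      using False h1 by (intro mult_mono) (auto simp: h_def)
    moreover have "real (w i) * success_prob E w i \<ge> 0" by (simp add: success_prob_def)
    ultimately show ?thesis by simp
  qed
  hence "(\<Sum>i\<in>UNIV. real (w i) * success_prob E w i) \<ge>
      (\<Sum>i\<in>UNIV. exp (- (real V / real B)) * (real (w i) * h i) - real B)"
    by (rule sum_mono)
  also have "(\<Sum>i\<in>UNIV. exp (- (real V / real B)) * (real (w i) * h i) - real B) =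
     exp (- (real V / real B)) * (\<Sum>i\<in>UNIV. real (w i) * h i) - real (CARD('v) * B)"
    by (simp add: sum_subtractf sum_distrib_left)
  also have "\<dots> \<ge> exp (- (real V / real B)) * (exp (-1) / real V * real (total_users w))
             - real (CARD('v) * B)"
    using gibbs_drift[OF \<open>sym E\<close> V, of w]
    by (intro diff_right_mono mult_left_mono) (auto simp: h_def s_def S_def)
  finally show ?thesis by (simp add: mult.assoc)
qed

text \<open>The correction factor tends to 1 as \<open>B\<close> grows, so some \<open>B\<close>
  keeps the service coefficient above the midpoint of \<open>rate\<close> and
  \<open>exp (-1) / V\<close>; \<open>c\<close> is half the gap between these two.\<close>

lemma drift_coefficient:
  fixes rate :: real and V :: nat
  assumes load: "rate < exp (-1) / real V"
  obtains B :: nat and c :: real where "B > 0" "c > 0"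
    "rate + c \<le> exp (- (real V / real B)) * (exp (-1) / real V)"
proof -
  define a where "a = exp (-1) / real V"
  have a: "rate < a" using load by (simp add: a_def)
  have "((\<lambda>B. exp (- (real V / real B)) * a) \<longlongrightarrow> exp (- 0) * a) sequentially"
    by (intro tendsto_intros tendsto_divide_0[OF tendsto_const])
  hence "eventually (\<lambda>B. exp (- (real V / real B)) * a > (rate + a) / 2) sequentially"
    using a by (intro order_tendstoD(1)) auto
  hence "eventually (\<lambda>B. B > 0 \<and> exp (- (real V / real B)) * a > (rate + a) / 2) sequentially"
    using eventually_gt_at_top[of 0] by eventually_elim auto
  then obtain B :: nat where "B > 0" "exp (- (real V / real B)) * a > (rate + a) / 2"
    using eventually_happens'[OF sequentially_bot] by blast
  thus ?thesis using a by (intro that[of B "(a - rate) / 2"]) (auto simp: a_def[symmetric] field_simps)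
qed

section \<open>From drift to linear decay\<close>

text \<open>While the norm is at least a threshold \<open>b\<close>, the drift dominates the
  quadratic term and each step removes at least \<open>c / 2\<close>; from below the threshold, one
  step overshoots it by at most \<open>D\<close>.\<close>

lemma norm_descent:
  fixes Y :: "nat \<Rightarrow> 'a::real_inner"
  assumes step: "\<And>k. k < n \<Longrightarrow> norm (Y (Suc k) - Y k) \<le> D"
    and drift: "\<And>k. k < n \<Longrightarrow> Y k \<bullet> (Y (Suc k) - Y k) \<le> a - c * norm (Y k)"
    and "c > 0" "a \<ge> 0" "D \<ge> 0" and "k \<le> n"
  shows "norm (Y k) \<le> max (norm (Y 0) - c / 2 * real k) ((2 * a + D\<^sup>2) / c + c + D)"
  using \<open>k \<le> n\<close>
proof (induction k)
  case (Suc k)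
  \<comment> \<open>The first summand lets half of the drift \<open>2 * c * norm (Y k)\<close>
    absorb \<open>2 * a + D\<^sup>2\<close> in the squared norm; the extra \<open>c\<close> makes
    \<open>norm (Y k) - c / 2\<close> nonnegative, so that square roots can be taken.\<close>
  define b where "b = (2 * a + D\<^sup>2) / c + c"
  have k: "k < n" using Suc.prems by simp
  show ?case
  proof (cases "norm (Y k) \<ge> b")
    case True
    have "(2 * a + D\<^sup>2) / c \<ge> 0" using assms by simp
    hence cY: "c \<le> norm (Y k)" using True by (simp add: b_def)
    have "(2 * a + D\<^sup>2) / c \<le> norm (Y k)" using True \<open>c > 0\<close> by (simp add: b_def)
    hence bY: "2 * a + D\<^sup>2 \<le> c * norm (Y k)" using \<open>c > 0\<close> by (simp add: field_simps)
    have "(norm (Y (Suc k)))\<^sup>2 = (norm (Y k + (Y (Suc k) - Y k)))\<^sup>2" by simp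
    also have "\<dots> = (norm (Y k))\<^sup>2 + 2 * (Y k \<bullet> (Y (Suc k) - Y k)) + (norm (Y (Suc k) - Y k))\<^sup>2"
      unfolding power2_norm_eq_inner by (simp only: inner_add_left inner_add_right inner_commute)
    also have "\<dots> \<le> (norm (Y k))\<^sup>2 + 2 * (a - c * norm (Y k)) + D\<^sup>2"
      using drift[OF k] step[OF k] by (intro add_mono mult_left_mono power_mono) auto
    also have "\<dots> \<le> (norm (Y k))\<^sup>2 - c * norm (Y k)" using bY by (simp add: right_diff_distrib)
    also have "\<dots> \<le> (norm (Y k))\<^sup>2 - c * norm (Y k) + c\<^sup>2 / 4" by simp
    also have "\<dots> = (norm (Y k) - c / 2)\<^sup>2" by (simp add: power2_diff power_divide algebra_simps)
    finally have "(norm (Y (Suc k)))\<^sup>2 \<le> (norm (Y k) - c / 2)\<^sup>2" .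
    hence "norm (Y (Suc k)) \<le> norm (Y k) - c / 2"
      by (rule power2_le_imp_le) (use cY \<open>c > 0\<close> in linarith)
    moreover have "norm (Y k) \<le> max (norm (Y 0) - c / 2 * real k) (b + D)"
      using Suc k by (simp add: b_def)
    ultimately show ?thesis
      using \<open>c > 0\<close> unfolding b_def by (simp add: le_max_iff_disj distrib_left) linarith
  next
    case False
    have "norm (Y (Suc k)) \<le> norm (Y k) + norm (Y (Suc k) - Y k)"
      by (metis add.commute diff_add_cancel norm_triangle_ineq)
    also have "\<dots> \<le> b + D" using False step[OF k] by simp
    finally show ?thesis by (simp add: b_def)
  qed
qed simp

text \<open>A deterministic statement about any path that stays within \<open>\<delta>\<close> of
  its accumulated drift; \<open>c\<close> and \<open>C\<close> depend neither on the path nor on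
  \<open>n\<close> or \<open>\<delta>\<close>. The descent is run on the accumulated drift
  \<open>Y\<close>, whose steps are bounded although those of \<open>w\<close> need not be.\<close>

lemma queue_decay:
  fixes E :: "('v::finite \<times> 'v) set" and rate :: real
  assumes "sym E" and V: "\<And>i. card (closed_nbhd E i) = V"
    and load: "rate < exp (-1) / real V" and "rate \<ge> 0"
  shows "\<exists>c>0. \<exists>C\<ge>0. \<forall>(w :: nat \<Rightarrow> 'v \<Rightarrow> nat) n \<delta>.
       (\<forall>k\<le>n. \<forall>i. \<bar>real (w k i) - real (w 0 i) - (\<Sum>j<k. rate - success_prob E (w j) i)\<bar> \<le> \<delta>) \<longrightarrow>
       (\<forall>k\<le>n. norm (\<chi> i. real (w k i)) \<le>
          max 0 (real (total_users (w 0)) - c * real k) + C * (1 + \<delta>))"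
proof -
  obtain B c where B: "B > 0" and c: "c > 0"
    and Bc: "rate + c \<le> exp (- (real V / real B)) * (exp (-1) / real V)"
    by (rule drift_coefficient[OF load])
  define K where "K = real (CARD('v))"
  define D where "D = K * (1 + rate)"
  define A0 where "A0 = K * real B"
  \<comment> \<open>Both terms pay for the distance between \<open>Y\<close> and the queues:
    \<open>D\<close> in the inner product with the drift, \<open>c * K\<close> in the norm.\<close>
  define A1 where "A1 = D + c * K"
  have nonneg: "K \<ge> 0" "D \<ge> 0" "A0 \<ge> 0" "A1 \<ge> 0"
    using \<open>rate \<ge> 0\<close> c by (simp_all add: K_def D_def A0_def A1_def)
  define C0 where "C0 = (2 * A0 + D\<^sup>2) / c + c + D"
  define C1 where "C1 = 2 * A1 / c + K"
  have C: "C0 \<ge> 0" "C1 \<ge> 0" using nonneg c by (simp_all add: C0_def C1_def)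
  have l1: "norm x \<le> (\<Sum>i\<in>UNIV. \<bar>x $ i\<bar>)" for x :: "real ^ 'v" by (rule norm_le_l1_cart)
  have main: "norm (\<chi> i. real (w k i)) \<le>
      max 0 (real (total_users (w 0)) - c / 2 * real k) + (C0 + C1) * (1 + \<delta>)"
    if close: "\<And>k i. k \<le> n \<Longrightarrow>
          \<bar>real (w k i) - real (w 0 i) - (\<Sum>j<k. rate - success_prob E (w j) i)\<bar> \<le> \<delta>" and k: "k \<le> n"
    for w :: "nat \<Rightarrow> 'v \<Rightarrow> nat" and n \<delta> k
  proof -
    define Y :: "nat \<Rightarrow> real ^ 'v" where
      "Y = (\<lambda>k. \<chi> i. real (w 0 i) + (\<Sum>j<k. rate - success_prob E (w j) i))"
    define Wv :: "nat \<Rightarrow> real ^ 'v" where "Wv = (\<lambda>k. \<chi> i. real (w k i))"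
    have \<delta>: "\<delta> \<ge> 0" using close[of 0] by force
    have diff: "\<bar>Wv k $ i - Y k $ i\<bar> \<le> \<delta>" if "k \<le> n" for k i
      using close[OF that] by (simp add: Y_def Wv_def algebra_simps)
    have norm_diff: "norm (Wv k - Y k) \<le> K * \<delta>" if "k \<le> n" for k
    proof -
      have "norm (Wv k - Y k) \<le> (\<Sum>i\<in>UNIV. \<bar>(Wv k - Y k) $ i\<bar>)" by (rule l1)
      also have "\<dots> \<le> (\<Sum>i\<in>(UNIV::'v set). \<delta>)" using diff[OF that] by (intro sum_mono) auto
      finally show ?thesis by (simp add: K_def)
    qed
    have inc: "Y (Suc k) - Y k = (\<chi> i. rate - success_prob E (w k) i)" for k
      by (simp add: Y_def vec_eq_iff)
    have abs_inc: "\<bar>rate - success_prob E (w k) i\<bar> \<le> 1 + rate" for k i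
      using \<open>rate \<ge> 0\<close> success_prob_bounds[of E "w k" i] by (simp add: abs_le_iff)
    have step: "norm (Y (Suc k) - Y k) \<le> D" for k
    proof -
      have "norm (Y (Suc k) - Y k) \<le> (\<Sum>i\<in>UNIV. \<bar>(Y (Suc k) - Y k) $ i\<bar>)" by (rule l1)
      also have "\<dots> \<le> (\<Sum>i\<in>(UNIV::'v set). 1 + rate)"
        unfolding inc using abs_inc by (intro sum_mono) auto
      finally show ?thesis by (simp add: K_def D_def)
    qed
    have drift: "Y k \<bullet> (Y (Suc k) - Y k) \<le> (A0 + A1 * \<delta>) - c * norm (Y k)" if "k < n" for k
    proof -
      let ?d = "\<lambda>i. rate - success_prob E (w k) i"
      have "Y k \<bullet> (Y (Suc k) - Y k) = (\<Sum>i\<in>UNIV. Y k $ i * ?d i)"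
        by (simp add: inc inner_vec_def)
      also have "\<dots> = (\<Sum>i\<in>UNIV. Wv k $ i * ?d i) + (\<Sum>i\<in>UNIV. (Y k $ i - Wv k $ i) * ?d i)"
        by (simp add: sum.distrib[symmetric] algebra_simps)
      also have "(\<Sum>i\<in>UNIV. (Y k $ i - Wv k $ i) * ?d i) \<le> (\<Sum>i\<in>(UNIV::'v set). \<delta> * (1 + rate))"
      proof (intro sum_mono)
        fix i :: 'v
        have "(Y k $ i - Wv k $ i) * ?d i \<le> \<bar>Wv k $ i - Y k $ i\<bar> * \<bar>?d i\<bar>"
          by (metis abs_ge_self abs_minus_commute abs_mult)
        also have "\<dots> \<le> \<delta> * (1 + rate)"
          using diff[of k i] abs_inc[of k i] that \<delta> by (intro mult_mono) auto
        finally show "(Y k $ i - Wv k $ i) * ?d i \<le> \<delta> * (1 + rate)" .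
      qed
      also have "(\<Sum>i\<in>(UNIV::'v set). \<delta> * (1 + rate)) = D * \<delta>" by (simp add: D_def K_def)
      also have "(\<Sum>i\<in>UNIV. Wv k $ i * ?d i) =
          rate * real (total_users (w k)) - (\<Sum>i\<in>UNIV. real (w k i) * success_prob E (w k) i)"
        by (simp add: Wv_def total_users_def right_diff_distrib sum_subtractf sum_distrib_left mult.commute)
      also have "\<dots> \<le> rate * real (total_users (w k)) -
          ((rate + c) * real (total_users (w k)) - A0)"
        using success_drift[OF \<open>sym E\<close> V B, of "w k"]
          mult_right_mono[OF Bc, of "real (total_users (w k))"] by (simp add: A0_def K_def)
      also have "\<dots> = A0 - c * real (total_users (w k))" by (simp add: algebra_simps)
      \<comment> \<open>The Euclidean norm is at most the number of users, so a drift proportional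
        to the latter is strong enough for \<open>norm_descent\<close>.\<close>
      also have "real (total_users (w k)) \<ge> norm (Y k) - K * \<delta>"
      proof -
        have "norm (Y k) \<le> norm (Wv k) + norm (Wv k - Y k)"
          by (metis norm_minus_commute norm_triangle_sub)
        also have "norm (Wv k) \<le> real (total_users (w k))"
          using l1[of "Wv k"] by (simp add: Wv_def total_users_def)
        finally show ?thesis using norm_diff[of k] that by simp
      qed
      hence "A0 - c * real (total_users (w k)) + D * \<delta> \<le> A0 - c * (norm (Y k) - K * \<delta>) + D * \<delta>"
        using c by (intro add_right_mono diff_left_mono mult_left_mono) auto
      also have "\<dots> = (A0 + A1 * \<delta>) - c * norm (Y k)" by (simp add: A1_def algebra_simps)
      finally show ?thesis by simp
    qed
    have "norm (Y k) \<le> max (norm (Y 0) - c / 2 * real k) ((2 * (A0 + A1 * \<delta>) + D\<^sup>2) / c + c + D)"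
      using step drift c k nonneg \<delta> by (intro norm_descent[where n = n]) auto
    also have "(2 * (A0 + A1 * \<delta>) + D\<^sup>2) / c + c + D = C0 + 2 * A1 / c * \<delta>"
      using c by (simp add: C0_def field_simps)
    also have "norm (Y 0) \<le> real (total_users (w 0))"
      using l1[of "Y 0"] by (simp add: Y_def total_users_def)
    finally have "norm (Y k) \<le> max 0 (real (total_users (w 0)) - c / 2 * real k) + (C0 + 2 * A1 / c * \<delta>)"
      using C nonneg c \<delta> by (smt (verit) divide_nonneg_pos mult_nonneg_nonneg)
    moreover have "norm (Wv k) \<le> norm (Y k) + norm (Wv k - Y k)"
      by (rule norm_triangle_sub)
    ultimately have "norm (Wv k) \<le> max 0 (real (total_users (w 0)) - c / 2 * real k) + (C0 + C1 * \<delta>)"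
      using norm_diff[OF k] by (simp add: C1_def algebra_simps)
    moreover have "C0 + C1 * \<delta> \<le> (C0 + C1) * (1 + \<delta>)"
      using C \<delta> by (simp add: algebra_simps)
    ultimately show ?thesis by (simp add: Wv_def)
  qed
  show ?thesis
  proof (rule exI[of _ "c / 2"], intro conjI, goal_cases)
    case 2
    show ?case
    proof (rule exI[of _ "C0 + C1"], intro conjI allI impI, goal_cases)
      case (2 w n \<delta> k)
      thus ?case by (intro main[of n]) blast+
    qed (use C in simp)
  qed (use c in simp)
qed


section \<open>Azuma's inequality\<close>

text \<open>The fibres of a countably valued map partition the space, so each integral is the sum of
  its restrictions to them. The fibrewise comparison plays the part of an inequality between
  conditional expectations.\<close>

lemma nn_integral_le_of_fibres:
  fixes H :: "'a \<Rightarrow> 'h::countable"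
  assumes [measurable]: "H \<in> measurable M (count_space UNIV)"
    and [measurable]: "f \<in> borel_measurable M" "g \<in> borel_measurable M"
    and le: "\<And>h. (\<integral>\<^sup>+\<omega>. f \<omega> * indicator {\<omega>\<in>space M. H \<omega> = h} \<omega> \<partial>M) \<le>
                 (\<integral>\<^sup>+\<omega>. g \<omega> * indicator {\<omega>\<in>space M. H \<omega> = h} \<omega> \<partial>M)"
  shows "(\<integral>\<^sup>+\<omega>. f \<omega> \<partial>M) \<le> (\<integral>\<^sup>+\<omega>. g \<omega> \<partial>M)"
proof -
  have sum: "(\<integral>\<^sup>+\<omega>. f \<omega> \<partial>M) =
      (\<integral>\<^sup>+h. (\<integral>\<^sup>+\<omega>. f \<omega> * indicator {\<omega>\<in>space M. H \<omega> = h} \<omega> \<partial>M) \<partial>count_space UNIV)"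
    if [measurable]: "f \<in> borel_measurable M" for f
  proof -
    \<comment> \<open>The image under \<open>H\<close> of the measure with density \<open>f\<close>;
      its mass at \<open>h\<close> is the integral of \<open>f\<close> over the fibre.\<close>
    let ?N = "distr (density M f) (count_space UNIV) H"
    have meas [measurable]: "H \<in> measurable (density M f) (count_space UNIV)" by simp
    have fibre: "emeasure ?N {h} = (\<integral>\<^sup>+\<omega>. f \<omega> * indicator {\<omega>\<in>space M. H \<omega> = h} \<omega> \<partial>M)" for h
    proof -
      have "H -` {h} \<inter> space M = {\<omega>\<in>space M. H \<omega> = h}" by auto
      thus ?thesis by (simp add: emeasure_distr emeasure_density)
    qed
    have "(\<integral>\<^sup>+\<omega>. f \<omega> \<partial>M) = (\<integral>\<^sup>+\<omega>. f \<omega> * indicator (space M) \<omega> \<partial>M)"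
      by (intro nn_integral_cong) simp
    also have "\<dots> = emeasure ?N UNIV"
      by (simp add: emeasure_distr emeasure_density)
    also have "\<dots> = (\<integral>\<^sup>+h. emeasure ?N {h} \<partial>count_space UNIV)"
      by (rule emeasure_countable_singleton) auto
    finally show ?thesis unfolding fibre .
  qed
  show ?thesis unfolding sum[OF assms(2)] sum[OF assms(3)] by (intro nn_integral_mono le)
qed

lemma exp_le_quadratic:
  fixes x :: real
  assumes "\<bar>x\<bar> \<le> 1"
  shows "exp x \<le> 1 + x + x\<^sup>2"
proof (cases "x \<ge> 0")
  case True
  thus ?thesis using assms by (intro exp_bound) auto
next
  case False
  define y where "y = - x"
  have y: "0 \<le> y" using False by (simp add: y_def)
  \<comment> \<open>For \<open>x = - y\<close> the claim reads
    \<open>1 \<le> exp y * (1 - y + y\<^sup>2)\<close>; it follows by factoring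
    \<open>1 + y ^ 3\<close> and using \<open>1 + y \<le> exp y\<close>.\<close>
  have "1 + 0 \<le> 1 + y ^ 3" using y by (intro add_left_mono) simp
  also have "\<dots> = (1 + y) * (1 - y + y\<^sup>2)" by (simp add: algebra_simps power2_eq_square power3_eq_cube)
  also have "\<dots> \<le> exp y * (1 - y + y\<^sup>2)"
  proof (rule mult_right_mono)
    have "1 - y + y\<^sup>2 = (y - 1 / 2)\<^sup>2 + 3 / 4" by (simp add: power2_eq_square algebra_simps)
    thus "0 \<le> 1 - y + y\<^sup>2" by simp
  qed (rule exp_ge_add_one_self)
  finally show ?thesis by (simp add: y_def exp_minus field_simps)
qed

text \<open>A discrete form of the Doob-Dynkin lemma: \<open>g\<close> evaluates \<open>f\<close> at
  a chosen representative of the fibre.\<close>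

lemma fibre_factor:
  fixes f :: "'a \<Rightarrow> 'b" and H :: "'a \<Rightarrow> 'h"
  assumes "\<And>\<omega> \<eta>. \<omega> \<in> S \<Longrightarrow> \<eta> \<in> S \<Longrightarrow> H \<omega> = H \<eta> \<Longrightarrow> f \<omega> = f \<eta>"
  obtains g where "\<And>\<omega>. \<omega> \<in> S \<Longrightarrow> f \<omega> = g (H \<omega>)"
proof
  fix \<omega> assume \<omega>: "\<omega> \<in> S"
  have "(SOME \<eta>. \<eta> \<in> S \<and> H \<eta> = H \<omega>) \<in> S \<and> H (SOME \<eta>. \<eta> \<in> S \<and> H \<eta> = H \<omega>) = H \<omega>"
    by (rule someI[of _ \<omega>]) (use \<omega> in simp)
  thus "f \<omega> = (\<lambda>h. f (SOME \<eta>. \<eta> \<in> S \<and> H \<eta> = h)) (H \<omega>)"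
    using assms[of \<omega> "SOME \<eta>. \<eta> \<in> S \<and> H \<eta> = H \<omega>"] \<omega> by simp
qed

text \<open>Conditioning on the past is restriction to the fibres of the countably valued history \<open>H n\<close>.\<close>

context prob_space
begin

text \<open>On a fibre of \<open>H n\<close> the sum of the earlier increments is constant, and the
  linear term in the quadratic bound for the new factor integrates to 0. Each step thus costs a
  factor of at most \<open>1 + \<theta>\<^sup>2 \<le> exp (\<theta>\<^sup>2)\<close>.\<close>

lemma azuma_exp_moment:
  fixes H :: "nat \<Rightarrow> 'a \<Rightarrow> 'h::countable" and d :: "nat \<Rightarrow> 'a \<Rightarrow> real"
  assumes H [measurable]: "\<And>n. H n \<in> measurable M (count_space UNIV)"
    and d [measurable]: "\<And>n. d n \<in> borel_measurable M"
    and adapted: "\<And>n k \<omega> \<eta>. k < n \<Longrightarrow> \<omega> \<in> space M \<Longrightarrow> \<eta> \<in> space M \<Longrightarrow> H n \<omega> = H n \<eta> \<Longrightarrow> d k \<omega> = d k \<eta>"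
    and bound: "\<And>n \<omega>. \<omega> \<in> space M \<Longrightarrow> \<bar>d n \<omega>\<bar> \<le> 1"
    and mart: "\<And>n h. expectation (\<lambda>\<omega>. d n \<omega> * indicator {\<omega>\<in>space M. H n \<omega> = h} \<omega>) = 0"
    and \<theta>: "\<bar>\<theta>\<bar> \<le> 1"
  shows "(\<integral>\<^sup>+\<omega>. ennreal (exp (\<theta> * (\<Sum>k<n. d k \<omega>))) \<partial>M) \<le> ennreal (exp (real n * \<theta>\<^sup>2))"
proof (induction n)
  case 0
  then show ?case by (simp add: emeasure_space_1)
next
  case (Suc n)
  let ?S = "\<lambda>n \<omega>. \<Sum>k<n. d k \<omega>"
  have "(\<integral>\<^sup>+\<omega>. ennreal (exp (\<theta> * ?S (Suc n) \<omega>)) \<partial>M) \<le>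
        (\<integral>\<^sup>+\<omega>. ennreal (exp (\<theta>\<^sup>2)) * ennreal (exp (\<theta> * ?S n \<omega>)) \<partial>M)"
  proof (rule nn_integral_le_of_fibres[OF H[of n]])
    fix h
    let ?F = "{\<omega>\<in>space M. H n \<omega> = h}"
    have F [measurable]: "?F \<in> events" by measurable
    show "(\<integral>\<^sup>+\<omega>. ennreal (exp (\<theta> * ?S (Suc n) \<omega>)) * indicator ?F \<omega> \<partial>M) \<le>
          (\<integral>\<^sup>+\<omega>. ennreal (exp (\<theta>\<^sup>2)) * ennreal (exp (\<theta> * ?S n \<omega>)) * indicator ?F \<omega> \<partial>M)"
    proof (cases "?F = {}")
      case True
      then show ?thesis by (simp only: True) simp
    next
      case False
      then obtain \<omega>0 where \<omega>0: "\<omega>0 \<in> ?F" by blast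
      define s where "s = ?S n \<omega>0"
      have s: "?S n \<omega> = s" if "\<omega> \<in> ?F" for \<omega>
        unfolding s_def using that \<omega>0 by (intro sum.cong refl adapted[of _ n]) auto
      have ind_int: "integrable M (\<lambda>\<omega>. d n \<omega> * indicator ?F \<omega> :: real)"
        using bound by (intro integrable_const_bound[of _ 1] AE_I2) (auto simp: indicator_def)
      have "(\<integral>\<^sup>+\<omega>. ennreal (exp (\<theta> * ?S (Suc n) \<omega>)) * indicator ?F \<omega> \<partial>M) \<le>
         (\<integral>\<^sup>+\<omega>. ennreal (exp (\<theta> * s) * ((1 + \<theta>\<^sup>2) * indicator ?F \<omega> + \<theta> * (d n \<omega> * indicator ?F \<omega>))) \<partial>M)"
      proof (rule nn_integral_mono)
        fix \<omega> assume \<omega>: "\<omega> \<in> space M"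
        show "ennreal (exp (\<theta> * ?S (Suc n) \<omega>)) * indicator ?F \<omega> \<le>
          ennreal (exp (\<theta> * s) * ((1 + \<theta>\<^sup>2) * indicator ?F \<omega> + \<theta> * (d n \<omega> * indicator ?F \<omega>)))"
        proof (cases "\<omega> \<in> ?F")
          case True
          have d1: "\<bar>d n \<omega>\<bar> \<le> 1" using bound \<omega> by simp
          have "\<bar>\<theta> * d n \<omega>\<bar> \<le> 1" using d1 \<theta> by (simp add: abs_mult mult_le_one)
          hence "exp (\<theta> * d n \<omega>) \<le> 1 + \<theta> * d n \<omega> + (\<theta> * d n \<omega>)\<^sup>2" by (rule exp_le_quadratic)
          also have "(\<theta> * d n \<omega>)\<^sup>2 \<le> \<theta>\<^sup>2 * 1"
            unfolding power_mult_distrib using d1 by (intro mult_left_mono) (auto simp: abs_square_le_1)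
          finally have "exp (\<theta> * d n \<omega>) \<le> 1 + \<theta>\<^sup>2 + \<theta> * d n \<omega>" by simp
          hence "exp (\<theta> * s) * exp (\<theta> * d n \<omega>) \<le> exp (\<theta> * s) * (1 + \<theta>\<^sup>2 + \<theta> * d n \<omega>)"
            by (intro mult_left_mono) auto
          thus ?thesis using True s[OF True]
            by (simp add: distrib_left exp_add ennreal_leI)
        next
          case False
          then show ?thesis by simp
        qed
      qed
      also have "\<dots> = ennreal (expectation (\<lambda>\<omega>. exp (\<theta> * s) * ((1 + \<theta>\<^sup>2) * indicator ?F \<omega> + \<theta> * (d n \<omega> * indicator ?F \<omega>))))"
      proof (rule nn_integral_eq_integral)
        show "integrable M (\<lambda>\<omega>. exp (\<theta> * s) * ((1 + \<theta>\<^sup>2) * indicator ?F \<omega> + \<theta> * (d n \<omega> * indicator ?F \<omega>)))"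
          using ind_int F by (intro integrable_mult_right Bochner_Integration.integrable_add) (auto simp: emeasure_finite less_top[symmetric])
        \<comment> \<open>Nonnegativity of the upper bound allows the passage from the extended
          integral to the expectation.\<close>
        show "AE \<omega> in M. 0 \<le> exp (\<theta> * s) * ((1 + \<theta>\<^sup>2) * indicator ?F \<omega> + \<theta> * (d n \<omega> * indicator ?F \<omega>))"
        proof (rule AE_I2)
          fix \<omega> assume \<omega>: "\<omega> \<in> space M"
          have "\<bar>\<theta> * d n \<omega>\<bar> \<le> 1" using bound[OF \<omega>, of n] \<theta> by (simp add: abs_mult mult_le_one)
          moreover have "\<theta>\<^sup>2 \<ge> 0" by simp
          ultimately have "0 \<le> 1 + \<theta>\<^sup>2 + \<theta> * d n \<omega>" by linarith
          thus "0 \<le> exp (\<theta> * s) * ((1 + \<theta>\<^sup>2) * indicator ?F \<omega> + \<theta> * (d n \<omega> * indicator ?F \<omega>))"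
            by (auto simp: indicator_def)
        qed
      qed
      also have "expectation (\<lambda>\<omega>. exp (\<theta> * s) * ((1 + \<theta>\<^sup>2) * indicator ?F \<omega> + \<theta> * (d n \<omega> * indicator ?F \<omega>))) =
          exp (\<theta> * s) * ((1 + \<theta>\<^sup>2) * prob ?F)"
        using ind_int mart[of n h] F by (simp add: less_top[symmetric])
      also have "\<dots> \<le> exp (\<theta> * s) * (exp (\<theta>\<^sup>2) * prob ?F)"
        using exp_ge_add_one_self[of "\<theta>\<^sup>2"] by (intro mult_left_mono mult_right_mono) auto
      also have "ennreal \<dots> = (\<integral>\<^sup>+\<omega>. ennreal (exp (\<theta>\<^sup>2) * exp (\<theta> * s)) * indicator ?F \<omega> \<partial>M)"
        using F by (subst nn_integral_cmult_indicator) (simp_all add: emeasure_eq_measure ennreal_mult mult_ac)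
      also have "\<dots> = (\<integral>\<^sup>+\<omega>. ennreal (exp (\<theta>\<^sup>2)) * ennreal (exp (\<theta> * ?S n \<omega>)) * indicator ?F \<omega> \<partial>M)"
        using s by (intro nn_integral_cong) (auto simp: indicator_def ennreal_mult)
      finally show ?thesis by (simp add: ennreal_leI)
    qed
  qed measurable
  also have "\<dots> = ennreal (exp (\<theta>\<^sup>2)) * (\<integral>\<^sup>+\<omega>. ennreal (exp (\<theta> * ?S n \<omega>)) \<partial>M)"
    by (rule nn_integral_cmult) measurable
  also have "\<dots> \<le> ennreal (exp (\<theta>\<^sup>2)) * ennreal (exp (real n * \<theta>\<^sup>2))"
    by (intro mult_left_mono Suc.IH) auto
  also have "\<dots> = ennreal (exp (real (Suc n) * \<theta>\<^sup>2))"
    by (simp add: ennreal_mult[symmetric] exp_add[symmetric] algebra_simps)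
  finally show ?case .
qed

text \<open>Markov's inequality for the exponential moment, applied to the sum with both signs
  \<open>\<sigma>\<close>. The parameter \<open>\<theta>\<close> stays free, to be chosen once the
  time horizon is fixed.\<close>

lemma azuma_tail:
  fixes H :: "nat \<Rightarrow> 'a \<Rightarrow> 'h::countable" and d :: "nat \<Rightarrow> 'a \<Rightarrow> real"
  assumes H [measurable]: "\<And>n. H n \<in> measurable M (count_space UNIV)"
    and d [measurable]: "\<And>n. d n \<in> borel_measurable M"
    and adapted: "\<And>n k \<omega> \<eta>. k < n \<Longrightarrow> \<omega> \<in> space M \<Longrightarrow> \<eta> \<in> space M \<Longrightarrow> H n \<omega> = H n \<eta> \<Longrightarrow> d k \<omega> = d k \<eta>"
    and bound: "\<And>n \<omega>. \<omega> \<in> space M \<Longrightarrow> \<bar>d n \<omega>\<bar> \<le> 1"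
    and mart: "\<And>n h. expectation (\<lambda>\<omega>. d n \<omega> * indicator {\<omega>\<in>space M. H n \<omega> = h} \<omega>) = 0"
    and \<theta>: "0 \<le> \<theta>" "\<theta> \<le> 1"
  shows "prob {\<omega>\<in>space M. \<bar>\<Sum>k<n. d k \<omega>\<bar> \<ge> a} \<le> 2 * exp (real n * \<theta>\<^sup>2 - \<theta> * a)"
proof -
  have upper: "prob {\<omega>\<in>space M. \<sigma> * (\<Sum>k<n. d k \<omega>) \<ge> a} \<le> exp (real n * \<theta>\<^sup>2 - \<theta> * a)"
    if \<sigma>: "\<bar>\<sigma>\<bar> = 1" for \<sigma>
  proof -
    let ?f = "\<lambda>\<omega>. ennreal (exp (\<theta> * \<sigma> * (\<Sum>k<n. d k \<omega>)))"
    let ?B = "{\<omega>\<in>space M. \<sigma> * (\<Sum>k<n. d k \<omega>) \<ge> a}"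
    have B: "?B \<in> events" by measurable
    have "emeasure M ?B \<le> (\<integral>\<^sup>+\<omega>. ennreal (exp (- \<theta> * a)) * ?f \<omega> \<partial>M)"
    proof -
      have "emeasure M ?B = (\<integral>\<^sup>+\<omega>. indicator ?B \<omega> \<partial>M)" using B by simp
      also have "\<dots> \<le> (\<integral>\<^sup>+\<omega>. ennreal (exp (- \<theta> * a)) * ?f \<omega> \<partial>M)"
      proof (rule nn_integral_mono)
        fix \<omega>
        show "indicator ?B \<omega> \<le> ennreal (exp (- \<theta> * a)) * ?f \<omega>"
        proof (cases "\<omega> \<in> ?B")
          case True
          hence "\<theta> * (\<sigma> * (\<Sum>k<n. d k \<omega>)) \<ge> \<theta> * a" using \<theta> by (intro mult_left_mono) auto
          hence "1 \<le> exp (- \<theta> * a) * exp (\<theta> * \<sigma> * (\<Sum>k<n. d k \<omega>))"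
            by (simp add: exp_add[symmetric] mult.assoc)
          thus ?thesis using True by (simp add: ennreal_mult[symmetric] ennreal_ge_1)
        qed simp
      qed
      finally show ?thesis .
    qed
    also have "\<dots> = ennreal (exp (- \<theta> * a)) * (\<integral>\<^sup>+\<omega>. ?f \<omega> \<partial>M)"
      by (rule nn_integral_cmult) measurable
    also have "(\<integral>\<^sup>+\<omega>. ?f \<omega> \<partial>M) \<le> ennreal (exp (real n * (\<theta> * \<sigma>)\<^sup>2))"
    proof (rule azuma_exp_moment[OF H d])
      show "\<bar>\<theta> * \<sigma>\<bar> \<le> 1" using \<theta> \<sigma> by (simp add: abs_mult)
    qed (fact adapted bound mart)+
    also have "(\<theta> * \<sigma>)\<^sup>2 = \<theta>\<^sup>2" using \<sigma> by (auto simp: power_mult_distrib abs_square_eq_1)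
    finally have "emeasure M ?B \<le> ennreal (exp (- \<theta> * a)) * ennreal (exp (real n * \<theta>\<^sup>2))"
      by (simp add: mult_left_mono)
    also have "\<dots> = ennreal (exp (real n * \<theta>\<^sup>2 - \<theta> * a))"
      by (simp add: ennreal_mult[symmetric] exp_add[symmetric])
    finally show ?thesis by (simp add: emeasure_eq_measure)
  qed
  have "{\<omega>\<in>space M. \<bar>\<Sum>k<n. d k \<omega>\<bar> \<ge> a} \<subseteq>
      {\<omega>\<in>space M. 1 * (\<Sum>k<n. d k \<omega>) \<ge> a} \<union> {\<omega>\<in>space M. (-1) * (\<Sum>k<n. d k \<omega>) \<ge> a}"
    by auto
  hence "prob {\<omega>\<in>space M. \<bar>\<Sum>k<n. d k \<omega>\<bar> \<ge> a} \<le>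
      prob ({\<omega>\<in>space M. 1 * (\<Sum>k<n. d k \<omega>) \<ge> a} \<union> {\<omega>\<in>space M. (-1) * (\<Sum>k<n. d k \<omega>) \<ge> a})"
    by (rule finite_measure_mono) measurable
  also have "\<dots> \<le> prob {\<omega>\<in>space M. 1 * (\<Sum>k<n. d k \<omega>) \<ge> a} + prob {\<omega>\<in>space M. (-1) * (\<Sum>k<n. d k \<omega>) \<ge> a}"
    by (rule measure_Un_le) measurable
  also have "\<dots> \<le> 2 * exp (real n * \<theta>\<^sup>2 - \<theta> * a)"
    using upper[of 1] upper[of "-1"] by simp
  finally show ?thesis .
qed

end


section \<open>Uniform control of the chains\<close>

text \<open>The averages are close to \<open>l\<close> only for long sums, but
  \<open>\<eta> * k + C\<close> bounds the deviation for every \<open>k\<close>, and for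
  \<open>k \<le> T * m\<close> this is at most \<open>\<epsilon> * m\<close> once \<open>m\<close>
  is large. The index is shifted because arrivals at time 0 never enter the recursion.\<close>

lemma partial_sums_uniformly_close:
  fixes a :: "nat \<Rightarrow> real"
  assumes lim: "(\<lambda>n. (\<Sum>k<n. a k) / real n) \<longlonglongrightarrow> l" and "\<epsilon> > 0"
  shows "eventually (\<lambda>m. \<forall>k\<le>T * m. \<bar>(\<Sum>j<k. a (Suc j)) - l * real k\<bar> \<le> \<epsilon> * real m) sequentially"
proof -
  define \<eta> where "\<eta> = \<epsilon> / (2 * (real T + 1))"
  have \<eta>: "\<eta> > 0" using \<open>\<epsilon> > 0\<close> by (simp add: \<eta>_def)
  define D where "D = (\<lambda>k. (\<Sum>j<k. a (Suc j)) - l * real k)"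
  from LIMSEQ_D[OF lim \<eta>] obtain n0 where
    n0: "\<And>n. n \<ge> n0 \<Longrightarrow> norm ((\<Sum>k<n. a k) / real n - l) < \<eta>" by blast
  \<comment> \<open>\<open>C\<close> collects the effect of the index shift and the finitely many
    short sums.\<close>
  define C where "C = \<bar>l - a 0\<bar> + \<eta> + (\<Sum>k<n0. \<bar>D k\<bar>)"
  have D: "\<bar>D k\<bar> \<le> \<eta> * real k + C" for k
  proof (cases "k < n0")
    case True
    have "\<bar>D k\<bar> \<le> (\<Sum>k<n0. \<bar>D k\<bar>)" using True by (intro member_le_sum) auto
    moreover have "0 \<le> \<eta> * real k" using \<eta> by simp
    ultimately show ?thesis using \<eta> unfolding C_def by linarith
  next
    case False
    have "norm ((\<Sum>k<Suc k. a k) / real (Suc k) - l) < \<eta>" using False by (intro n0) simp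
    also have "(\<Sum>k<Suc k. a k) / real (Suc k) - l = ((\<Sum>k<Suc k. a k) - l * real (Suc k)) / real (Suc k)"
      by (simp add: field_simps del: sum.lessThan_Suc)
    finally have "\<bar>(\<Sum>k<Suc k. a k) - l * real (Suc k)\<bar> < \<eta> * real (Suc k)"
      by (simp add: abs_divide pos_divide_less_eq del: sum.lessThan_Suc of_nat_Suc)
    moreover have "(\<Sum>k<Suc k. a k) = a 0 + (\<Sum>j<k. a (Suc j))" by (rule sum.lessThan_Suc_shift)
    ultimately have "\<bar>D k + (a 0 - l)\<bar> < \<eta> * real k + \<eta>" by (simp add: D_def algebra_simps)
    moreover have "0 \<le> (\<Sum>k<n0. \<bar>D k\<bar>)" by (intro sum_nonneg) simp
    ultimately show ?thesis unfolding C_def by linarith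
  qed
  have "C \<ge> 0" using D[of 0] by (simp add: D_def)
  have "\<bar>D k\<bar> \<le> \<epsilon> * real m" if "real m \<ge> 2 * C / \<epsilon>" "k \<le> T * m" for m k
  proof -
    have "\<eta> * real k \<le> \<eta> * (real T * real m)"
      using that(2) \<eta> by (intro mult_left_mono) (simp_all flip: of_nat_mult)
    also have "\<dots> \<le> \<eta> * (real T + 1) * real m" using \<eta> by (simp add: algebra_simps)
    also have "\<eta> * (real T + 1) = \<epsilon> / 2" by (simp add: \<eta>_def field_simps)
    finally have "\<eta> * real k \<le> \<epsilon> / 2 * real m" .
    moreover have "C \<le> \<epsilon> / 2 * real m" using that(1) \<open>\<epsilon> > 0\<close> by (simp add: field_simps)
    ultimately show ?thesis using D[of k] by simp
  qed
  moreover have "eventually (\<lambda>m. real m \<ge> 2 * C / \<epsilon>) sequentially"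
    using filterlim_real_sequentially by (simp add: filterlim_at_top)
  ultimately show ?thesis by (auto simp: D_def elim!: eventually_mono)
qed

lemma card_total_users_le: "finite {x :: 'v::finite \<Rightarrow> nat. total_users x = m}"
  "card {x :: 'v::finite \<Rightarrow> nat. total_users x = m} \<le> (m + 1) ^ CARD('v)"
proof -
  have sub: "{x :: 'v \<Rightarrow> nat. total_users x = m} \<subseteq> PiE UNIV (\<lambda>_. {..m})"
  proof
    fix x :: "'v \<Rightarrow> nat" assume "x \<in> {x. total_users x = m}"
    hence "x i \<le> m" for i
      using member_le_sum[of i UNIV x] by (auto simp: total_users_def)
    thus "x \<in> PiE UNIV (\<lambda>_. {..m})" by auto
  qed
  have fin: "finite (PiE (UNIV :: 'v set) (\<lambda>_. {..m}))" by (intro finite_PiE) auto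
  show "finite {x :: 'v \<Rightarrow> nat. total_users x = m}" by (rule finite_subset[OF sub fin])
  have "card {x :: 'v \<Rightarrow> nat. total_users x = m} \<le> card (PiE (UNIV :: 'v set) (\<lambda>_. {..m}))"
    by (rule card_mono[OF fin sub])
  thus "card {x :: 'v \<Rightarrow> nat. total_users x = m} \<le> (m + 1) ^ CARD('v)"
    by (simp add: card_PiE)
qed

text \<open>Half of the exponential rate eventually absorbs the polynomial; the other half leaves a
  geometric series.\<close>

lemma summable_polynomial_exp:
  fixes \<beta> :: real
  assumes "\<beta> > 0"
  shows "summable (\<lambda>m. (real m + 1) ^ d * exp (- \<beta> * real m))"
proof (rule summable_comparison_test_ev)
  define b where "b = \<beta> / 2"
  have b: "b > 0" using assms by (simp add: b_def)
  have "filterlim (\<lambda>m. b * (real m + 1)) at_top sequentially"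
    by (rule filterlim_tendsto_pos_mult_at_top[OF tendsto_const b], subst add.commute)
       (rule filterlim_tendsto_add_at_top[OF tendsto_const filterlim_real_sequentially])
  from filterlim_compose[OF tendsto_power_div_exp_0 this]
  have "((\<lambda>m. (b * (real m + 1)) ^ d / exp (b * (real m + 1))) \<longlongrightarrow> 0) sequentially" .
  hence "eventually (\<lambda>m. (b * (real m + 1)) ^ d / exp (b * (real m + 1)) < b ^ d / exp b) sequentially"
    using b by (intro order_tendstoD) auto
  thus "eventually (\<lambda>m. norm ((real m + 1) ^ d * exp (- \<beta> * real m)) \<le> exp (- \<beta> / 2) ^ m) sequentially"
  proof eventually_elim
    case (elim m)
    have "b ^ d * (real m + 1) ^ d = (b * (real m + 1)) ^ d"
      by (simp only: power_mult_distrib)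
    also have "\<dots> < b ^ d / exp b * exp (b * (real m + 1))"
      using elim by (subst (asm) pos_divide_less_eq) simp_all
    also have "exp (b * (real m + 1)) = exp b * exp (b * real m)"
      by (simp add: distrib_left exp_add)
    finally have "b ^ d * (real m + 1) ^ d < b ^ d * exp (b * real m)" by simp
    hence "(real m + 1) ^ d \<le> exp (b * real m)" using b by simp
    hence "(real m + 1) ^ d * exp (- \<beta> * real m) \<le> exp (\<beta> / 2 * real m) * exp (- \<beta> * real m)"
      unfolding b_def by (intro mult_right_mono) simp_all
    also have "\<dots> = exp (- \<beta> / 2) ^ m"
      by (simp add: exp_add[symmetric] exp_of_nat_mult[symmetric] field_simps)
    finally show ?case by simp
  qed
  show "summable (\<lambda>m. exp (- \<beta> / 2) ^ m)" using assms by (intro summable_geometric) simp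
qed

section \<open>Martingale structure and concentration of the chains\<close>

context random_access_model
begin

lemma A_measurable [measurable]: "A n \<in> measurable M (count_space UNIV)"
  using A_indep by (simp add: indep_vars_def)

lemmas N_measurable [measurable]

lemma past_eq_iff:
  "past A N x n \<omega> = past A N x n \<eta> \<longleftrightarrow>
     (\<forall>k\<in>{1..n}. A k \<omega> = A k \<eta>) \<and> (\<forall>k<n. N x k \<omega> = N x k \<eta>)"
  by (auto simp: past_def)

lemma past_measurable [measurable]: "past A N x n \<in> measurable M (count_space UNIV)"
  unfolding measurable_count_space_eq2_countable
proof (intro conjI ballI)
  fix h
  show "past A N x n -` {h} \<inter> space M \<in> events"
  proof (cases "past A N x n -` {h} \<inter> space M = {}")
    case False
    then obtain \<omega>0 where "h = past A N x n \<omega>0" by blast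
    hence "past A N x n -` {h} \<inter> space M =
        {\<omega>\<in>space M. (\<forall>k\<in>{1..n}. A k \<omega> = A k \<omega>0) \<and> (\<forall>k\<in>{..<n}. N x k \<omega> = N x k \<omega>0)}"
      by (auto simp: past_eq_iff)
    also have "\<dots> \<in> events"
      by (intro sets.sets_Collect_conj sets.sets_Collect_finite_All) auto
    finally show ?thesis .
  qed simp
qed auto

lemma W_step:
  assumes "\<omega> \<in> space M"
  shows "real (W x (Suc n) \<omega> i) =
    real (W x n \<omega> i) + real (A (Suc n) \<omega> i) - of_bool (N x n \<omega> \<in> success_event E i)"
proof -
  have "(\<Prod>j\<in>closed_nbhd E i - {i}. of_bool (N x n \<omega> j = 0) :: int) =
      of_bool (\<forall>j\<in>closed_nbhd E i - {i}. N x n \<omega> j = 0)"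
    by (cases "\<forall>j\<in>closed_nbhd E i - {i}. N x n \<omega> j = 0") (auto intro!: prod.neutral)
  hence "int (W x (Suc n) \<omega> i) =
      int (W x n \<omega> i) + int (A (Suc n) \<omega> i) - of_bool (N x n \<omega> \<in> success_event E i)"
    using W_Suc[OF assms, of x n i] by (simp add: success_event_def)
  hence "real_of_int (int (W x (Suc n) \<omega> i)) =
      real_of_int (int (W x n \<omega> i) + int (A (Suc n) \<omega> i) - of_bool (N x n \<omega> \<in> success_event E i))"
    by simp
  thus ?thesis by simp
qed

lemma W_past:
  assumes "\<omega> \<in> space M" "\<eta> \<in> space M" "past A N x n \<omega> = past A N x n \<eta>"
  shows "W x n \<omega> = W x n \<eta>"
  using assms(3)
proof (induction n)
  case 0
  then show ?case using assms W_0 by simp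
next
  case (Suc n)
  have "W x n \<omega> = W x n \<eta>" "A (Suc n) \<omega> = A (Suc n) \<eta>" "N x n \<omega> = N x n \<eta>"
    using Suc by (auto simp: past_eq_iff)
  hence "real (W x (Suc n) \<omega> i) = real (W x (Suc n) \<eta> i)" for i
    using W_step[OF assms(1), of x n i] W_step[OF assms(2), of x n i] by simp
  thus ?case by (intro ext) simp
qed

text \<open>Measurability of the queues is derived: by the recursion they are a function of the
  countably valued past.\<close>

lemma W_measurable [measurable]: "W x n \<in> measurable M (count_space UNIV)"
proof -
  obtain g where "\<And>\<omega>. \<omega> \<in> space M \<Longrightarrow> W x n \<omega> = g (past A N x n \<omega>)"
    using fibre_factor[of "space M" "past A N x n" "W x n"] W_past by metis
  hence "W x n \<in> measurable M (count_space UNIV) \<longleftrightarrow>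
      (\<lambda>\<omega>. g (past A N x n \<omega>)) \<in> measurable M (count_space UNIV)"
    by (rule measurable_cong)
  thus ?thesis by simp
qed

text \<open>These are the increments of the departure martingale: the subtracted term is the
  conditional probability of success given the past.\<close>

definition compensated_departure :: "('v \<Rightarrow> nat) \<Rightarrow> 'v \<Rightarrow> nat \<Rightarrow> 'w \<Rightarrow> real" where
  "compensated_departure x i n \<omega> =
     of_bool (N x n \<omega> \<in> success_event E i) - success_prob E (W x n \<omega>) i"

lemma compensated_departure_measurable [measurable]:
  "compensated_departure x i n \<in> borel_measurable M"
proof -
  have "(\<lambda>\<omega>. of_bool (N x n \<omega> \<in> success_event E i) :: real) \<in> borel_measurable M"
    by (rule measurable_compose[OF N_measurable]) simp
  moreover have "(\<lambda>\<omega>. success_prob E (W x n \<omega>) i) \<in> borel_measurable M"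
    by (rule measurable_compose[OF W_measurable]) simp
  ultimately show ?thesis
    unfolding compensated_departure_def[abs_def] by (rule borel_measurable_diff)
qed

lemma abs_compensated_departure_le: "\<bar>compensated_departure x i n \<omega>\<bar> \<le> 1"
  using success_prob_bounds[of E "W x n \<omega>" i]
  by (cases "N x n \<omega> \<in> success_event E i") (simp_all add: compensated_departure_def)

text \<open>The model prescribes conditional probabilities of single outcomes; countable additivity
  extends them to events. The product form also covers pasts of probability 0, about which the
  conditional law says nothing.\<close>

lemma prob_attempts_past:
  fixes x :: "'v \<Rightarrow> nat" and n :: nat
  assumes \<omega>: "\<omega> \<in> space M"
  defines "F \<equiv> {\<eta>\<in>space M. past A N x n \<eta> = past A N x n \<omega>}"
  shows "prob {\<eta>\<in>F. N x n \<eta> \<in> B} = prob F * measure_pmf.prob (attempts_pmf E (W x n \<omega>)) B"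
proof -
  have F [measurable]: "F \<in> events" unfolding F_def by measurable
  have single: "prob {\<eta>\<in>F. N x n \<eta> = y} = prob F * pmf (attempts_pmf E (W x n \<omega>)) y" for y
  proof (cases "prob F = 0")
    case True
    have "prob {\<eta>\<in>F. N x n \<eta> = y} \<le> prob F" by (intro finite_measure_mono F) auto
    thus ?thesis using True measure_nonneg[of M] by (simp add: order_antisym)
  next
    case False
    hence "prob F > 0" using measure_nonneg[of M F] by linarith
    moreover have "{\<eta>\<in>F. N x n \<eta> = y} = {\<eta>\<in>space M. N x n \<eta> = y \<and> past A N x n \<eta> = past A N x n \<omega>}"
      by (auto simp: F_def)
    ultimately show ?thesis
      using N_law[OF \<omega>, of x n y] False by (simp add: cond_prob_def F_def field_simps)
  qed
  have "emeasure M {\<eta>\<in>F. N x n \<eta> \<in> B} = emeasure M (\<Union>y\<in>B. {\<eta>\<in>F. N x n \<eta> = y})"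
    by (intro arg_cong[of _ _ "emeasure M"]) auto
  also have "\<dots> = (\<integral>\<^sup>+y. emeasure M {\<eta>\<in>F. N x n \<eta> = y} \<partial>count_space B)"
  proof (rule emeasure_UN_countable)
    show "{\<eta>\<in>F. N x n \<eta> = y} \<in> events" for y
    proof -
      have "{\<eta>\<in>F. N x n \<eta> = y} = F \<inter> (N x n -` {y} \<inter> space M)" by (auto simp: F_def)
      thus ?thesis using measurable_sets[OF N_measurable, of "{y}" x n] by auto
    qed
  qed (auto simp: disjoint_family_on_def)
  also have "\<dots> = (\<integral>\<^sup>+y. ennreal (prob F) * ennreal (pmf (attempts_pmf E (W x n \<omega>)) y) \<partial>count_space B)"
    by (intro nn_integral_cong) (simp add: emeasure_eq_measure single ennreal_mult)
  also have "\<dots> = ennreal (prob F) * emeasure (attempts_pmf E (W x n \<omega>)) B"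
    by (simp add: nn_integral_cmult nn_integral_pmf)
  also have "\<dots> = ennreal (prob F * measure_pmf.prob (attempts_pmf E (W x n \<omega>)) B)"
    by (simp add: measure_pmf.emeasure_eq_measure ennreal_mult)
  finally show ?thesis by (simp add: emeasure_eq_measure)
qed

text \<open>The martingale property. On a fibre of the past the queue vector is constant, so the
  subtracted term is a constant there and \<open>prob_attempts_past\<close> evaluates the
  rest.\<close>

lemma compensated_departure_past:
  "expectation (\<lambda>\<omega>. compensated_departure x i n \<omega> * indicator {\<omega>\<in>space M. past A N x n \<omega> = h} \<omega>) = 0"
proof (cases "\<exists>\<omega>\<in>space M. past A N x n \<omega> = h")
  case True
  then obtain \<omega> where \<omega>: "\<omega> \<in> space M" and h: "h = past A N x n \<omega>" by auto
  define F where "F = {\<eta>\<in>space M. past A N x n \<eta> = past A N x n \<omega>}"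
  define G where "G = {\<eta>\<in>F. N x n \<eta> \<in> success_event E i}"
  have F [measurable]: "F \<in> events" unfolding F_def by measurable
  have "G = F \<inter> (N x n -` success_event E i \<inter> space M)" by (auto simp: F_def G_def)
  hence G [measurable]: "G \<in> events"
    using measurable_sets[OF N_measurable, of "success_event E i" x n] by auto
  have "compensated_departure x i n \<eta> * indicator F \<eta> =
      indicator G \<eta> - success_prob E (W x n \<omega>) i * indicator F \<eta>" for \<eta>
    using W_past[OF _ \<omega>, of \<eta> x n]
    by (auto simp: compensated_departure_def F_def G_def indicator_def)
  hence "expectation (\<lambda>\<eta>. compensated_departure x i n \<eta> * indicator F \<eta>) =
      prob G - success_prob E (W x n \<omega>) i * prob F"
    by (simp add: less_top[symmetric])
  also have "\<dots> = 0"
    using prob_attempts_past[OF \<omega>, of x n "success_event E i"]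
    by (simp add: G_def F_def success_prob_def)
  finally show ?thesis by (simp add: F_def h)
next
  case False
  hence "{\<omega>\<in>space M. past A N x n \<omega> = h} = {}" by auto
  then show ?thesis by (simp only:) simp
qed

lemma departure_deviation:
  assumes "0 \<le> \<theta>" "\<theta> \<le> 1"
  shows "prob {\<omega>\<in>space M. \<bar>\<Sum>k<n. compensated_departure x i k \<omega>\<bar> \<ge> a} \<le> 2 * exp (real n * \<theta>\<^sup>2 - \<theta> * a)"
proof (rule azuma_tail[where H = "past A N x"])
  fix n k \<omega> \<eta>
  assume k: "k < n" and \<omega>: "\<omega> \<in> space M" "\<eta> \<in> space M" and eq: "past A N x n \<omega> = past A N x n \<eta>"
  have "past A N x k \<omega> = past A N x k \<eta>" "N x k \<omega> = N x k \<eta>"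
    using eq k by (auto simp: past_eq_iff)
  thus "compensated_departure x i k \<omega> = compensated_departure x i k \<eta>"
    using W_past[OF \<omega>] by (simp add: compensated_departure_def)
qed (use assms in \<open>auto simp: abs_compensated_departure_le compensated_departure_past\<close>)

text \<open>A union bound over initial states, vertices and times, valid for any joint law of the
  chains. It multiplies the exponentially small tail by a polynomial in \<open>m\<close>, so
  Borel-Cantelli applies.\<close>

lemma departures_uniformly_close:
  assumes "0 < \<epsilon>" "\<epsilon> \<le> 1" and T: "T > 0"
  shows "AE \<omega> in M. eventually (\<lambda>m. \<forall>x i k. total_users x = m \<longrightarrow> k \<le> T * m \<longrightarrow>
           \<bar>\<Sum>j<k. compensated_departure x i j \<omega>\<bar> \<le> \<epsilon> * real m) sequentially"
proof -
  define I where "I = (\<lambda>m. {x :: 'v \<Rightarrow> nat. total_users x = m} \<times> (UNIV :: 'v set) \<times> {..T * m})"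
  define B where "B = (\<lambda>m (x, i, k). {\<omega>\<in>space M. \<bar>\<Sum>j<k. compensated_departure x i j \<omega>\<bar> \<ge> \<epsilon> * real m})"
  \<comment> \<open>This \<open>\<theta>\<close> minimises
    \<open>T * \<theta>\<^sup>2 - \<theta> * \<epsilon>\<close>, and the minimum is
    \<open>- \<beta>\<close>.\<close>
  define \<theta> where "\<theta> = \<epsilon> / (2 * real T)"
  define \<beta> where "\<beta> = \<epsilon>\<^sup>2 / (4 * real T)"
  have \<theta>: "0 \<le> \<theta>" "\<theta> \<le> 1" and "\<beta> > 0"
    using assms by (auto simp: \<theta>_def \<beta>_def field_simps)
  have finI: "finite (I m)" for m
    unfolding I_def by (intro finite_cartesian_product card_total_users_le) auto
  have B_ev: "B m p \<in> events" for m p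
    unfolding B_def by (cases p) simp
  have prob_B: "prob (B m p) \<le> 2 * exp (- \<beta> * real m)" if "p \<in> I m" for m p
  proof -
    obtain x i k where p: "p = (x, i, k)" by (cases p) auto
    have "k \<le> T * m" using that by (simp add: I_def p)
    hence k: "real k \<le> real T * real m" by (simp flip: of_nat_mult)
    have "prob (B m p) \<le> 2 * exp (real k * \<theta>\<^sup>2 - \<theta> * (\<epsilon> * real m))"
      unfolding B_def p by (simp add: departure_deviation[OF \<theta>])
    also have "real k * \<theta>\<^sup>2 - \<theta> * (\<epsilon> * real m) \<le> real T * real m * \<theta>\<^sup>2 - \<theta> * (\<epsilon> * real m)"
      using k by (intro diff_right_mono mult_right_mono) auto
    also have "\<dots> = - \<beta> * real m"
      using T by (simp add: \<theta>_def \<beta>_def power2_eq_square field_simps)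
    finally show ?thesis by simp
  qed
  have card_I: "real (card (I m)) \<le> real CARD('v) * real T * (real m + 1) ^ (CARD('v) + 1)" for m
  proof -
    have "card (I m) = card {x :: 'v \<Rightarrow> nat. total_users x = m} * (CARD('v) * (T * m + 1))"
      by (simp add: I_def card_cartesian_product)
    \<comment> \<open>Since \<open>T \<ge> 1\<close>, the number \<open>T * m + 1\<close> of times
      is at most \<open>T * (m + 1)\<close>.\<close>
    also have "\<dots> \<le> (m + 1) ^ CARD('v) * (CARD('v) * (T * m + T))"
      using T by (intro mult_mono card_total_users_le) auto
    finally have "real (card (I m)) \<le> real ((m + 1) ^ CARD('v) * (CARD('v) * (T * m + T)))"
      by (simp only: of_nat_le_iff)
    thus ?thesis by (simp add: algebra_simps)
  qed
  have "summable (\<lambda>m. prob (\<Union>p\<in>I m. B m p))"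
  proof (rule summable_comparison_test)
    show "\<exists>N. \<forall>m\<ge>N. norm (prob (\<Union>p\<in>I m. B m p)) \<le>
        2 * real CARD('v) * real T * ((real m + 1) ^ (CARD('v) + 1) * exp (- \<beta> * real m))"
    proof (intro exI allI impI)
      fix m
      have "prob (\<Union>p\<in>I m. B m p) \<le> (\<Sum>p\<in>I m. prob (B m p))"
        by (rule finite_measure_subadditive_finite) (use finI B_ev in auto)
      also have "\<dots> \<le> (\<Sum>p\<in>I m. 2 * exp (- \<beta> * real m))" by (intro sum_mono prob_B)
      also have "\<dots> = real (card (I m)) * (2 * exp (- \<beta> * real m))" by simp
      also have "\<dots> \<le> real CARD('v) * real T * (real m + 1) ^ (CARD('v) + 1) * (2 * exp (- \<beta> * real m))"
        by (intro mult_right_mono card_I) simp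
      finally show "norm (prob (\<Union>p\<in>I m. B m p)) \<le>
        2 * real CARD('v) * real T * ((real m + 1) ^ (CARD('v) + 1) * exp (- \<beta> * real m))"
        by (simp only: real_norm_def abs_of_nonneg[OF measure_nonneg] mult_ac)
    qed
    show "summable (\<lambda>m. 2 * real CARD('v) * real T * ((real m + 1) ^ (CARD('v) + 1) * exp (- \<beta> * real m)))"
      by (intro summable_mult summable_polynomial_exp \<open>\<beta> > 0\<close>)
  qed
  hence "AE \<omega> in M. eventually (\<lambda>m. \<omega> \<in> space M - (\<Union>p\<in>I m. B m p)) sequentially"
    by (intro borel_cantelli_AE1 sets.finite_UN finI B_ev) (auto simp: less_top[symmetric])
  thus ?thesis
  proof eventually_elim
    case (elim \<omega>)
    thus ?case
    proof eventually_elim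
      case (elim m)
      show ?case
      proof (intro allI impI)
        fix x :: "'v \<Rightarrow> nat" and i k assume "total_users x = m" "k \<le> T * m"
        hence "\<omega> \<notin> B m (x, i, k)" using elim by (auto simp: I_def)
        thus "\<bar>\<Sum>j<k. compensated_departure x i j \<omega>\<bar> \<le> \<epsilon> * real m"
          using elim by (auto simp: B_def)
      qed
    qed
  qed
qed

lemma arrivals_strong_law:
  "AE \<omega> in M. (\<lambda>n. (\<Sum>k<n. real (A k \<omega> i)) / real n) \<longlonglongrightarrow> arr_rate i"
proof -
  have "AE \<omega> in M. (\<lambda>n. (\<Sum>k<n. real (A k \<omega> i)) / real n) \<longlonglongrightarrow> expectation (\<lambda>\<omega>. real (A 0 \<omega> i))"
  proof (rule strong_law_nonneg)
    show "indep_vars (\<lambda>_. borel) (\<lambda>k \<omega>. real (A k \<omega> i)) UNIV"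
      by (rule indep_vars_compose2[OF A_indep, of "\<lambda>_ a. real (a i)"]) simp
    show "distr M borel (\<lambda>\<omega>. real (A n \<omega> i)) = distr M borel (\<lambda>\<omega>. real (A 0 \<omega> i))" for n
      using distr_distr[of "\<lambda>a. real (a i)" "count_space UNIV" borel "A n" M]
        distr_distr[of "\<lambda>a. real (a i)" "count_space UNIV" borel "A 0" M] A_ident[of n]
      by (simp add: o_def)
  qed (simp_all add: A_integrable)
  thus ?thesis by (simp add: A_mean)
qed

text \<open>A Doob-type decomposition: the deviation from the accumulated drift is the fluctuation
  of the arrivals, left to the strong law, minus the departure martingale, left to Azuma's
  inequality.\<close>

lemma queue_decomposition:
  assumes "\<omega> \<in> space M"
  shows "real (W x k \<omega> i) - real (W x 0 \<omega> i) - (\<Sum>j<k. arr_rate i - success_prob E (W x j \<omega>) i) =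
    ((\<Sum>j<k. real (A (Suc j) \<omega> i)) - arr_rate i * real k) - (\<Sum>j<k. compensated_departure x i j \<omega>)"
proof (induction k)
  case (Suc k)
  then show ?case
    using W_step[OF assms, of x k i] by (simp add: compensated_departure_def algebra_simps)
qed simp

text \<open>The time \<open>t = 1 / c\<close> is when decay at rate \<open>c\<close> has used up the
  \<open>m\<close> initial users; afterwards only the error term of \<open>queue_decay\<close>
  remains. A single null set serves all \<open>T\<close> and \<open>\<epsilon>\<close>.\<close>

lemma queues_uniformly_small:
  assumes rate: "\<And>i. arr_rate i = rate" and V: "\<And>i. card (closed_nbhd E i) = V"
    and load: "rate < exp (-1) / real V"
  obtains t where "t > 0"
    "AE \<omega> in M. \<forall>T \<epsilon>. \<epsilon> > 0 \<longrightarrow> eventually (\<lambda>m. \<forall>x k. total_users x = m \<longrightarrow>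
       t * real m \<le> real k \<longrightarrow> k \<le> T * m \<longrightarrow> norm (\<chi> i. real (W x k \<omega> i)) \<le> \<epsilon> * real m) sequentially"
proof -
  have "rate \<ge> 0" using rate_pos rate by (metis less_imp_le)
  obtain c C where c: "c > 0" and C: "C \<ge> 0" and decay:
    "\<forall>(w :: nat \<Rightarrow> 'v \<Rightarrow> nat) n \<delta>.
       (\<forall>k\<le>n. \<forall>i. \<bar>real (w k i) - real (w 0 i) - (\<Sum>j<k. rate - success_prob E (w j) i)\<bar> \<le> \<delta>) \<longrightarrow>
       (\<forall>k\<le>n. norm (\<chi> i. real (w k i)) \<le>
          max 0 (real (total_users (w 0)) - c * real k) + C * (1 + \<delta>))"
    using queue_decay[OF undirected V load \<open>rate \<ge> 0\<close>] by blast
  have "AE \<omega> in M. \<forall>i. (\<lambda>n. (\<Sum>k<n. real (A k \<omega> i)) / real n) \<longlonglongrightarrow> arr_rate i"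
    by (subst AE_all_countable) (intro allI arrivals_strong_law)
  \<comment> \<open>\<open>Suc T\<close> is a positive horizon and \<open>1 / real (Suc l)\<close> a
    tolerance in \<open>(0, 1]\<close>, as the union bound requires; both range over countable
    sets.\<close>
  moreover have "AE \<omega> in M. \<forall>T l. eventually (\<lambda>m. \<forall>x i k. total_users x = m \<longrightarrow> k \<le> Suc T * m \<longrightarrow>
           \<bar>\<Sum>j<k. compensated_departure x i j \<omega>\<bar> \<le> 1 / real (Suc l) * real m) sequentially"
    unfolding AE_all_countable by (intro allI departures_uniformly_close) auto
  ultimately have "AE \<omega> in M. \<forall>T \<epsilon>. \<epsilon> > 0 \<longrightarrow> eventually (\<lambda>m. \<forall>x k. total_users x = m \<longrightarrow>
       1 / c * real m \<le> real k \<longrightarrow> k \<le> T * m \<longrightarrow> norm (\<chi> i. real (W x k \<omega> i)) \<le> \<epsilon> * real m) sequentially"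
    using AE_space
  proof eventually_elim
    case (elim \<omega>)
    note \<omega> = elim(3)
    show ?case
    proof (intro allI impI)
      fix T :: nat and \<epsilon> :: real assume "\<epsilon> > 0"
      \<comment> \<open>Arrivals and departures each deviate by at most \<open>\<eta> * m\<close>,
        so \<open>\<delta> = 2 * \<eta> * m\<close>. This choice of \<open>l\<close> keeps
        \<open>C * \<delta>\<close> within half of \<open>\<epsilon> * m\<close>; large
        \<open>m\<close> puts the constant \<open>C\<close> into the other half.\<close>
      obtain l where l: "1 / real (Suc l) < \<epsilon> / (4 * (C + 1))"
        using nat_approx_posE[of "\<epsilon> / (4 * (C + 1))"] \<open>\<epsilon> > 0\<close> C by auto
      define \<eta> where "\<eta> = 1 / real (Suc l)"
      have \<eta>: "\<eta> > 0" by (simp add: \<eta>_def)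
      have C\<eta>: "C * (2 * \<eta>) \<le> \<epsilon> / 2"
      proof -
        have "C * (2 * \<eta>) \<le> (C + 1) * (2 * (\<epsilon> / (4 * (C + 1))))"
          using l C \<eta> by (intro mult_mono) (auto simp: \<eta>_def)
        also have "\<dots> = \<epsilon> / 2" using C by (simp add: field_simps)
        finally show ?thesis .
      qed
      have arr: "eventually (\<lambda>m. \<forall>i. \<forall>k\<le>Suc T * m. \<bar>(\<Sum>j<k. real (A (Suc j) \<omega> i)) - rate * real k\<bar> \<le> \<eta> * real m) sequentially"
        using elim(1) \<eta> unfolding rate
        by (intro eventually_all_finite partial_sums_uniformly_close) auto
      have "eventually (\<lambda>m. real m \<ge> 2 * C / \<epsilon>) sequentially"
        using filterlim_real_sequentially by (simp add: filterlim_at_top)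
      with arr elim(2)[rule_format, of T l]
      show "eventually (\<lambda>m. \<forall>x k. total_users x = m \<longrightarrow>
       1 / c * real m \<le> real k \<longrightarrow> k \<le> T * m \<longrightarrow> norm (\<chi> i. real (W x k \<omega> i)) \<le> \<epsilon> * real m) sequentially"
      proof eventually_elim
        case (elim m)
        show ?case
        proof (intro allI impI)
          fix x :: "'v \<Rightarrow> nat" and k assume x: "total_users x = m" and k: "1 / c * real m \<le> real k" "k \<le> T * m"
          have "norm (\<chi> i. real (W x k \<omega> i)) \<le>
              max 0 (real (total_users (W x 0 \<omega>)) - c * real k) + C * (1 + 2 * \<eta> * real m)"
          proof (rule decay[THEN spec, of "\<lambda>k. W x k \<omega>", THEN spec, of "Suc T * m", THEN spec, THEN mp, rule_format])
            fix k i assume k: "k \<le> Suc T * m"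
            have "\<bar>(\<Sum>j<k. real (A (Suc j) \<omega> i)) - rate * real k\<bar> \<le> \<eta> * real m"
              using elim(1) k by blast
            moreover have "\<bar>\<Sum>j<k. compensated_departure x i j \<omega>\<bar> \<le> \<eta> * real m"
              using elim(2) x k unfolding \<eta>_def by blast
            ultimately show "\<bar>real (W x k \<omega> i) - real (W x 0 \<omega> i) -
                (\<Sum>j<k. rate - success_prob E (W x j \<omega>) i)\<bar> \<le> 2 * \<eta> * real m"
              using queue_decomposition[OF \<omega>, of x k i] unfolding rate by linarith
          qed (use k in simp)
          also have "real (total_users (W x 0 \<omega>)) - c * real k \<le> 0"
            using k(1) c x W_0[OF \<omega>] by (simp add: field_simps)
          hence "max 0 (real (total_users (W x 0 \<omega>)) - c * real k) = 0" by simp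
          also have "0 + C * (1 + 2 * \<eta> * real m) = C + C * (2 * \<eta>) * real m"
            by (simp add: algebra_simps)
          also have "\<dots> \<le> \<epsilon> / 2 * real m + \<epsilon> / 2 * real m"
            using elim(3) C\<eta> \<open>\<epsilon> > 0\<close> by (intro add_mono mult_right_mono) (auto simp: field_simps)
          finally show "norm (\<chi> i. real (W x k \<omega> i)) \<le> \<epsilon> * real m" by simp
        qed
      qed
    qed
  qed
  thus ?thesis using c by (intro that[of "1 / c"]) auto
qed

end

section \<open>Passage to the fluid limits\<close>

text \<open>\<open>z t\<close> is the limit of the scaled paths at the times
  \<open>\<mu> n t\<close>, which eventually lie within 1 of \<open>t\<close>. The corresponding
  discrete times fall into the window where the queues are uniformly small.\<close>

lemma fluid_limit_zero:
  fixes W :: "('v::finite \<Rightarrow> nat) \<Rightarrow> nat \<Rightarrow> 'w \<Rightarrow> 'v \<Rightarrow> nat"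
  assumes small: "\<And>T \<epsilon>. \<epsilon> > 0 \<Longrightarrow> eventually (\<lambda>m. \<forall>x k. total_users x = m \<longrightarrow>
       t\<^sub>1 * real m \<le> real k \<longrightarrow> k \<le> T * m \<longrightarrow> norm (\<chi> i. real (W x k \<omega> i)) \<le> \<epsilon> * real m) sequentially"
    and z: "z \<in> fluid_limits W \<omega>" and "t\<^sub>1 \<ge> 0" "t \<ge> t\<^sub>1 + 1"
  shows "z t = 0"
proof -
  obtain x r \<mu> where x: "filterlim (\<lambda>n. total_users (x n)) at_top sequentially"
    and r: "strict_mono r" and \<mu>: "uniform_limit {0..} \<mu> (\<lambda>s. s) sequentially"
    and lim: "\<And>T. T \<ge> 0 \<Longrightarrow>
      uniform_limit {0..T} (\<lambda>n s. ((\<lambda>n. scaled_path W \<omega> (x n)) \<circ> r) n (\<mu> n s)) z sequentially"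
    using z unfolding fluid_limits_def skorokhod_accumulation_point_def skorokhod_tendsto_def by blast
  have t: "t \<ge> 0" using assms by simp
  have \<mu>t: "(\<lambda>n. \<mu> n t) \<longlonglongrightarrow> t" by (rule tendsto_uniform_limitI[OF \<mu>]) (use t in simp)
  have zt: "(\<lambda>n. scaled_path W \<omega> (x (r n)) (\<mu> n t)) \<longlonglongrightarrow> z t"
    using tendsto_uniform_limitI[OF lim[OF t], of t] t by simp
  have m: "filterlim (\<lambda>n. total_users (x (r n))) at_top sequentially"
    by (rule filterlim_compose[OF x filterlim_subseq[OF r]])
  have bound: "norm (z t) \<le> \<epsilon>" if "\<epsilon> > 0" for \<epsilon>
  proof (rule Lim_norm_ubound[OF _ zt])
    \<comment> \<open>Beyond \<open>t\<close>, one unit allows for the time change and one for the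
      ceiling, which adds at most 1 and hence at most the number of users.\<close>
    define T where "T = nat \<lceil>t\<rceil> + 2"
    have "eventually (\<lambda>n. \<forall>y k. total_users y = total_users (x (r n)) \<longrightarrow>
       t\<^sub>1 * real (total_users (x (r n))) \<le> real k \<longrightarrow> k \<le> T * total_users (x (r n)) \<longrightarrow>
       norm (\<chi> i. real (W y k \<omega> i)) \<le> \<epsilon> * real (total_users (x (r n)))) sequentially"
      by (rule eventually_compose_filterlim[OF small[OF that] m])
    moreover have "eventually (\<lambda>n. total_users (x (r n)) \<ge> 1) sequentially"
      using m by (simp add: filterlim_at_top)
    moreover have "eventually (\<lambda>n. \<mu> n t > t - 1) sequentially" "eventually (\<lambda>n. \<mu> n t < t + 1) sequentially"
      using order_tendstoD[OF \<mu>t] by simp_all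
    ultimately show "eventually (\<lambda>n. norm (scaled_path W \<omega> (x (r n)) (\<mu> n t)) \<le> \<epsilon>) sequentially"
    proof eventually_elim
      case (elim n)
      define l where "l = total_users (x (r n))"
      define k where "k = nat \<lceil>real l * \<mu> n t\<rceil>"
      have l: "real l \<ge> 1" using elim(2) by (simp add: l_def)
      have "t\<^sub>1 * real l \<le> real l * \<mu> n t"
        using elim(3) assms(4) l by (simp add: mult.commute mult_left_mono)
      also have "\<dots> \<le> real k" unfolding k_def by linarith
      finally have k1: "t\<^sub>1 * real l \<le> real k" .
      have "real l * \<mu> n t \<ge> 0" using elim(3) assms l by (intro mult_nonneg_nonneg) auto
      hence "real k \<le> real l * \<mu> n t + 1" unfolding k_def by linarith
      also have "\<dots> \<le> real l * (t + 1) + real l"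
        using elim(4) l by (intro add_mono mult_left_mono) auto
      also have "\<dots> = real l * (t + 2)" by (simp add: algebra_simps)
      also have "\<dots> \<le> real l * real T"
        using l unfolding T_def by (intro mult_left_mono) linarith+
      finally have k2: "k \<le> T * l" by (simp add: mult.commute flip: of_nat_mult)
      have "norm (\<chi> i. real (W (x (r n)) k \<omega> i)) \<le> \<epsilon> * real l"
        using elim(1) k1 k2 unfolding l_def by blast
      moreover have "scaled_path W \<omega> (x (r n)) (\<mu> n t) =
          (1 / real l) *\<^sub>R (\<chi> i. real (W (x (r n)) k \<omega> i))"
        by (simp add: scaled_path_def vec_eq_iff k_def l_def)
      ultimately show ?case using l by (simp add: divide_simps mult.commute)
    qed
  qed simp
  have "norm (z t) \<le> 0"
  proof (rule field_le_epsilon)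
    fix e :: real assume "e > 0"
    from bound[OF this] show "norm (z t) \<le> 0 + e" by simp
  qed
  thus ?thesis by simp
qed

theorem theorem2:
  fixes M :: "'w measure"
    and E :: "('v::finite \<times> 'v) set"
    and arr_rate :: "'v \<Rightarrow> real"
    and A :: "nat \<Rightarrow> 'w \<Rightarrow> 'v \<Rightarrow> nat"
    and N W :: "('v \<Rightarrow> nat) \<Rightarrow> nat \<Rightarrow> 'w \<Rightarrow> 'v \<Rightarrow> nat"
    and rate :: real and V :: nat
  assumes model: "random_access_model M E arr_rate A N W"
    and symmetric_rate: "\<And>i. arr_rate i = rate"
    and symmetric_nbhd: "\<And>i. card (closed_nbhd E i) = V"
    and load: "rate < exp (-1) / real V"
  shows "fluid_model_stable M W"
proof -
  interpret random_access_model M E arr_rate A N W by (rule model)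
  obtain t where t: "t > 0" and small:
    "AE \<omega> in M. \<forall>T \<epsilon>. \<epsilon> > 0 \<longrightarrow> eventually (\<lambda>m. \<forall>x k. total_users x = m \<longrightarrow>
       t * real m \<le> real k \<longrightarrow> k \<le> T * m \<longrightarrow> norm (\<chi> i. real (W x k \<omega> i)) \<le> \<epsilon> * real m) sequentially"
    by (rule queues_uniformly_small[OF symmetric_rate symmetric_nbhd load])
  show ?thesis
    unfolding fluid_model_stable_def
  proof (intro exI conjI)
    \<comment> \<open>The unit added to \<open>t\<close> is the room for the time change that
      \<open>fluid_limit_zero\<close> asks for.\<close>
    show "AE \<omega> in M. \<forall>z\<in>fluid_limits W \<omega>. \<forall>s\<ge>t + 1. z s = 0"
      using small
    proof eventually_elim
      case (elim \<omega>)
      thus ?case using t by (intro ballI allI impI fluid_limit_zero[of t W \<omega>]) auto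
    qed
  qed (use t in simp)
qed

end
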